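(* Fix $\delta>0$, $m\in\mathbb N$, and let $(w^m_\delta,\lambda^m_\delta)$ be a solution of the one-step equation (OS) below with $\lambda^m_\delta>r(f)$. Then \[ w^m_\delta(x)=\sup_{\tau\in\mathcal T^\delta_{x,b}}\ln\mathbb E_x\Big[e^{\int_0^{\tau\wedge\tau_{B_m}}(f(X_s)-\lambda^m_\delta)ds+Mw^m_\delta(X_{\tau\wedge\tau_{B_m}})}\Big],\qquad x\in B_m. \]
   Context: $X$ is a standard Feller–Markov process with values in a locally compact separable metric space $(E,\rho)$, laws $\mathbb P_x$, expectations $\mathbb E_x$, transition probabilities $P_t(x,A)$. $U\subseteq E$ compact, $B_m\supset U$ compact. $f:E\to(-\infty,0]$ bounded continuous; $c:E\times U\to(-\infty,0]$ bounded continuous; $Mh(x):=\sup_{\xi\in U}(c(x,\xi)+h(\xi))$. $\tau_{B_m}:=\delta\inf\{k\in\mathbb N:X_{k\delta}\notin B_m\}$. $\mathcal T^\delta_{x,b}$ is the family of $\mathbb P_x$-a.s. bounded stopping times with values in $\{0,\delta,2\delta,\dots\}\cup\{\infty\}$. $r(f):=\lim_{t\to\infty}\frac1t\ln\sup_{x\in E}\mathbb E_x[e^{\int_0^tf(X_s)ds}]$. (OS): $\lambda^m_\delta\in\mathbb R$, $w^m_\delta$ bounded continuous on $B_m$, $w^m_\delta=Mw^m_\delta$ off $B_m$, and for $x\in B_m$: $w^m_\delta(x)=\max\big(\ln\mathbb E_x[e^{\int_0^\delta(f(X_s)-\lambda^m_\delta)ds+1_{\{X_\delta\in B_m\}}w^m_\delta(X_\delta)+1_{\{X_\delta\notin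 B_m\}}Mw^m_\delta(X_\delta)}],\ Mw^m_\delta(x)\big)$. Standing assumptions: (A2) $x\mapsto P_t(x,\cdot)$ is continuous in total variation for each $t>0$; (A3) for each compact $\Gamma$, $t_0,r_0>0$: $\sup_{x\in\Gamma}\mathbb P_x[\sup_{s\le t_0}\rho(X_s,x)\ge r]\to0$ as $r\to\infty$ and $\sup_{x\in\Gamma}\mathbb P_x[\sup_{s\le t}\rho(X_s,x)\ge r_0]\to0$ as $t\to0$; (A4) $\mathbb P_x[\tau_{B_m}<\infty]=1$ for all $x$. *)

theory Defs
  imports "HOL-Analysis.Analysis" "HOL-Probability.Probability"
begin

text \<open>A process is given by a measurable space Omega (sample space), a family of
probability laws P x (x in the state space), a filtration F (as a family of
sigma-algebras of subsets of the sample space), and the paths X t w.\<close>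

definition filtration_on :: "'w measure \<Rightarrow> (real \<Rightarrow> 'w set set) \<Rightarrow> bool" where
  "filtration_on Omega F \<longleftrightarrow>
     (\<forall>t\<ge>0. sigma_algebra (space Omega) (F t) \<and> F t \<subseteq> sets Omega) \<and>
     (\<forall>s t. 0 \<le> s \<and> s \<le> t \<longrightarrow> F s \<subseteq> F t) \<and>
     (\<forall>t\<ge>0. F t = (\<Inter>u\<in>{t<..}. F u))"

definition stopping_time_on :: "'w measure \<Rightarrow> (real \<Rightarrow> 'w set set) \<Rightarrow> ('w \<Rightarrow> ennreal) \<Rightarrow> bool" where
  "stopping_time_on Omega F T \<longleftrightarrow>
     (\<forall>t\<ge>0. {w \<in> space Omega. T w \<le> ennreal t} \<in> F t)"

definition pre_stopping_sigma :: "'w measure \<Rightarrow> (real \<Rightarrow> 'w set set) \<Rightarrow> ('w \<Rightarrow> ennreal) \<Rightarrow> 'w set set" where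
  "pre_stopping_sigma Omega F T =
     {A \<in> sets Omega. \<forall>t\<ge>0. A \<inter> {w \<in> space Omega. T w \<le> ennreal t} \<in> F t}"

definition vanishes_at_infinity :: "('a::metric_space \<Rightarrow> real) \<Rightarrow> bool" where
  "vanishes_at_infinity g \<longleftrightarrow> (\<forall>e>0. \<exists>K. compact K \<and> (\<forall>x. x \<notin> K \<longrightarrow> \<bar>g x\<bar> < e))"

definition standard_feller_markov ::
  "'w measure \<Rightarrow> ('a::metric_space \<Rightarrow> 'w measure) \<Rightarrow> (real \<Rightarrow> 'w set set) \<Rightarrow> (real \<Rightarrow> 'w \<Rightarrow> 'a) \<Rightarrow> bool" where
  "standard_feller_markov Omega P F X \<longleftrightarrow>
     (\<forall>x. prob_space (P x) \<and> sets (P x) = sets Omega) \<and>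
     (\<forall>A\<in>sets Omega. (\<lambda>x. emeasure (P x) A) \<in> borel_measurable borel) \<and>
     filtration_on Omega F \<and>
     (\<forall>t\<ge>0. X t \<in> measurable Omega borel \<and> (\<forall>B\<in>sets borel. {w \<in> space Omega. X t w \<in> B} \<in> F t)) \<and>
     (\<forall>x. measure (P x) {w \<in> space Omega. X 0 w = x} = 1) \<and>
     (\<forall>w\<in>space Omega. \<forall>t\<ge>0. continuous (at_right t) (\<lambda>s. X s w) \<and>
        (t > 0 \<longrightarrow> (\<exists>l. ((\<lambda>s. X s w) \<longlongrightarrow> l) (at_left t)))) \<and>
     \<comment> \<open>strong Markov property (contains the simple Markov property: constant T)\<close>
     (\<forall>x T A s (g::'a \<Rightarrow> real).
        stopping_time_on Omega F T \<and> A \<in> pre_stopping_sigma Omega F T \<and> s \<ge> 0 \<and>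
        g \<in> borel_measurable borel \<and> bounded (range g) \<longrightarrow>
        (\<integral>w. indicator (A \<inter> {w. T w < \<infinity>}) w * g (X (enn2real (T w) + s) w) \<partial>P x) =
        (\<integral>w. indicator (A \<inter> {w. T w < \<infinity>}) w *
               (\<integral>v. g (X s v) \<partial>P (X (enn2real (T w)) w)) \<partial>P x)) \<and>
     \<comment> \<open>quasi-left-continuity\<close>
     (\<forall>x Tn T. (\<forall>n. stopping_time_on Omega F (Tn n)) \<and> stopping_time_on Omega F T \<and>
        (\<forall>w\<in>space Omega. incseq (\<lambda>n. Tn n w) \<and> (\<lambda>n. Tn n w) \<longlonglongrightarrow> T w) \<longrightarrow>
        (AE w in P x. T w < \<infinity> \<longrightarrow>
           (\<lambda>n. X (enn2real (Tn n w)) w) \<longlonglongrightarrow> X (enn2real (T w)) w)) \<and>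
     \<comment> \<open>Feller property\<close>
     (\<forall>g::'a \<Rightarrow> real. continuous_on UNIV g \<and> vanishes_at_infinity g \<longrightarrow>
        (\<forall>t\<ge>0. continuous_on UNIV (\<lambda>x. \<integral>w. g (X t w) \<partial>P x) \<and>
                vanishes_at_infinity (\<lambda>x. \<integral>w. g (X t w) \<partial>P x)) \<and>
        (\<forall>x. ((\<lambda>t. \<integral>w. g (X t w) \<partial>P x) \<longlongrightarrow> g x) (at_right 0)))"

definition trans_prob :: "'w measure \<Rightarrow> ('a \<Rightarrow> 'w measure) \<Rightarrow> (real \<Rightarrow> 'w \<Rightarrow> 'a) \<Rightarrow> real \<Rightarrow> 'a \<Rightarrow> 'a set \<Rightarrow> real" where
  "trans_prob Omega P X t x A = measure (P x) {w \<in> space Omega. X t w \<in> A}"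

definition assumption_A2 :: "'w measure \<Rightarrow> ('a::metric_space \<Rightarrow> 'w measure) \<Rightarrow> (real \<Rightarrow> 'w \<Rightarrow> 'a) \<Rightarrow> bool" where
  "assumption_A2 Omega P X \<longleftrightarrow>
     (\<forall>t>0. \<forall>x. \<forall>e>0. \<exists>d>0. \<forall>y. dist y x < d \<longrightarrow>
        (SUP A\<in>sets borel. \<bar>trans_prob Omega P X t y A - trans_prob Omega P X t x A\<bar>) < e)"

text \<open>(A3).  The uniform limits (sup over x in Gamma) are written out with epsilons.\<close>
definition assumption_A3 :: "'w measure \<Rightarrow> ('a::metric_space \<Rightarrow> 'w measure) \<Rightarrow> (real \<Rightarrow> 'w \<Rightarrow> 'a) \<Rightarrow> bool" where
  "assumption_A3 Omega P X \<longleftrightarrow>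
     (\<forall>\<Gamma> t0 r0. compact \<Gamma> \<and> t0 > 0 \<and> r0 > 0 \<longrightarrow>
        (\<forall>e>0. \<forall>\<^sub>F r in at_top. \<forall>x\<in>\<Gamma>.
           measure (P x) {w \<in> space Omega. (SUP s\<in>{0..t0}. dist (X s w) x) \<ge> r} < e) \<and>
        (\<forall>e>0. \<forall>\<^sub>F t in at_right 0. \<forall>x\<in>\<Gamma>.
           measure (P x) {w \<in> space Omega. (SUP s\<in>{0..t}. dist (X s w) x) \<ge> r0} < e))"

text \<open>Index of the first exit from B along the grid delta*N:
  tau_B = delta * exit_index delta X B.\<close>
definition exit_index :: "real \<Rightarrow> (real \<Rightarrow> 'w \<Rightarrow> 'a) \<Rightarrow> 'a set \<Rightarrow> 'w \<Rightarrow> enat" where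
  "exit_index \<delta> X B w =
     (if \<exists>k::nat. X (real k * \<delta>) w \<notin> B then enat (LEAST k::nat. X (real k * \<delta>) w \<notin> B) else \<infinity>)"

definition assumption_A4 :: "'w measure \<Rightarrow> ('a \<Rightarrow> 'w measure) \<Rightarrow> (real \<Rightarrow> 'w \<Rightarrow> 'a) \<Rightarrow> real \<Rightarrow> 'a set \<Rightarrow> bool" where
  "assumption_A4 Omega P X \<delta> B \<longleftrightarrow>
     (\<forall>x. measure (P x) {w \<in> space Omega. exit_index \<delta> X B w < \<infinity>} = 1)"

text \<open>The family T^delta_{x,b}: a stopping time with values in {0,delta,2delta,...} u {infinity}
  is represented by its index sigma (tau = delta * sigma); it is P_x-a.s. bounded.\<close>
definition grid_stopping_times_bdd ::
  "'w measure \<Rightarrow> ('a \<Rightarrow> 'w measure) \<Rightarrow> (real \<Rightarrow> 'w set set) \<Rightarrow> real \<Rightarrow> 'a \<Rightarrow> ('w \<Rightarrow> enat) set" where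
  "grid_stopping_times_bdd Omega P F \<delta> x =
     {\<sigma>. (\<forall>k::nat. {w \<in> space Omega. \<sigma> w = enat k} \<in> F (real k * \<delta>)) \<and>
         (\<exists>N::nat. AE w in P x. \<sigma> w \<le> enat N)}"

definition Mop :: "('a \<Rightarrow> 'a \<Rightarrow> real) \<Rightarrow> 'a set \<Rightarrow> ('a \<Rightarrow> real) \<Rightarrow> 'a \<Rightarrow> real" where
  "Mop c U h x = (SUP \<xi>\<in>U. c x \<xi> + h \<xi>)"

definition path_int :: "(real \<Rightarrow> 'w \<Rightarrow> 'a) \<Rightarrow> ('a \<Rightarrow> real) \<Rightarrow> real \<Rightarrow> 'w \<Rightarrow> real" where
  "path_int X g t w = integral {0..t} (\<lambda>s. g (X s w))"

definition risk_rate :: "('a \<Rightarrow> 'w measure) \<Rightarrow> (real \<Rightarrow> 'w \<Rightarrow> 'a) \<Rightarrow> ('a \<Rightarrow> real) \<Rightarrow> real" where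
  "risk_rate P X f = Lim at_top (\<lambda>t. (1 / t) * ln (SUP x. \<integral>w. exp (path_int X f t w) \<partial>P x))"

definition OS_solution ::
  "'w measure \<Rightarrow> ('a::metric_space \<Rightarrow> 'w measure) \<Rightarrow> (real \<Rightarrow> 'w \<Rightarrow> 'a) \<Rightarrow> ('a \<Rightarrow> real) \<Rightarrow>
   ('a \<Rightarrow> 'a \<Rightarrow> real) \<Rightarrow> 'a set \<Rightarrow> 'a set \<Rightarrow> real \<Rightarrow> ('a \<Rightarrow> real) \<Rightarrow> real \<Rightarrow> bool" where
  "OS_solution Omega P X f c U B \<delta> w lam \<longleftrightarrow>
     continuous_on B w \<and> bounded (w ` B) \<and>
     (\<forall>x. x \<notin> B \<longrightarrow> w x = Mop c U w x) \<and>
     (\<forall>x\<in>B. w x = max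
        (ln (\<integral>v. exp (path_int X (\<lambda>y. f y - lam) \<delta> v +
                (if X \<delta> v \<in> B then w (X \<delta> v) else Mop c U w (X \<delta> v))) \<partial>P x))
        (Mop c U w x))"

text \<open>The value functional ln E_x[exp(int_0^{tau ^ tau_B}(f-lambda) + Mw(X_{tau ^ tau_B}))]
  for a grid stopping time with index sigma (the stopped index is a.s. finite).\<close>
definition stopped_value ::
  "'w measure \<Rightarrow> ('a \<Rightarrow> 'w measure) \<Rightarrow> (real \<Rightarrow> 'w \<Rightarrow> 'a) \<Rightarrow> ('a \<Rightarrow> real) \<Rightarrow>
   ('a \<Rightarrow> 'a \<Rightarrow> real) \<Rightarrow> 'a set \<Rightarrow> 'a set \<Rightarrow> real \<Rightarrow> ('a \<Rightarrow> real) \<Rightarrow> real \<Rightarrow> ('w \<Rightarrow> enat) \<Rightarrow> 'a \<Rightarrow> real" where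
  "stopped_value Omega P X f c U B \<delta> w lam \<sigma> x =
     ln (\<integral>v. (let t = real (the_enat (min (\<sigma> v) (exit_index \<delta> X B v))) * \<delta> in
               exp (path_int X (\<lambda>y. f y - lam) t v + Mop c U w (X t v))) \<partial>P x)"

end

theory Submission
  imports Defs
begin

text \<open>
  Put \<open>Z\<^sub>k = exp (\<integral>\<^sub>0\<^bsup>k\<delta>\<^esup> (f - \<lambda>)(X\<^sub>s) ds + w(X\<^bsub>k\<delta>\<^esub>))\<close>. By the one-step equation and the Markov property,
  \<open>Z\<close> stopped at the exit from \<open>B\<close> is a supermartingale, and \<open>Mw \<le> w\<close>; optional stopping bounds every
  stopped value by \<open>w\<close>. Up to the first grid time \<open>\<tau>\<close> at which \<open>w = Mw\<close> (which does not exceed the exit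
  time, since \<open>w = Mw\<close> off \<open>B\<close>) the stopped process is a martingale, so stopping at \<open>\<tau> \<and> N\<delta>\<close> loses at most
  \<open>E[Z\<^sub>N; \<tau> > N\<delta>] \<le> e\<^bsup>\<parallel>w\<parallel>\<^esup> E[exp (\<integral>\<^sub>0\<^bsup>N\<delta>\<^esup> (f - \<lambda>)(X\<^sub>s) ds)]\<close>. This tends to \<open>0\<close> because \<open>\<lambda> > r(f)\<close>; that \<open>r(f)\<close> is
  a genuine limit is Fekete's lemma for \<open>t \<mapsto> ln sup\<^sub>x E\<^sub>x[exp \<integral>\<^sub>0\<^sup>t f(X\<^sub>s) ds]\<close>.

  The Markov property is only given for functions of the position at a single time. Paths are
  right-continuous, so the additive functional is a limit of right-endpoint Riemann sums, and the
  Markov property for its exponential follows by iteration and dominated convergence.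
\<close>

subsection \<open>Real analysis and exit indices\<close>

lemma has_integral_ceiling_step:
  fixes h :: "real \<Rightarrow> real"
  assumes d: "d > 0"
  shows "((\<lambda>s. h (real_of_int \<lceil>s / d\<rceil> * d)) has_integral (\<Sum>i=1..m. d * h (real i * d))) {0..real m * d}"
proof (induction m)
  case 0
  then show ?case using has_integral_refl(2)[of _ "0::real"] by simp
next
  case (Suc m)
  have "((\<lambda>s. h (real (Suc m) * d)) has_integral (d * h (real (Suc m) * d))) (cbox (real m * d) (real (Suc m) * d))"
    using has_integral_const_real[of "h (real (Suc m) * d)" "real m * d" "real (Suc m) * d"] d
    by (simp add: algebra_simps)
  moreover have "h (real_of_int \<lceil>s / d\<rceil> * d) = h (real (Suc m) * d)"
    if "s \<in> box (real m * d) (real (Suc m) * d)" for s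
  proof -
    have "real m < s / d" "s / d \<le> real (Suc m)"
      using that d by (auto simp: field_simps)
    then have "\<lceil>s / d\<rceil> = int (Suc m)"
      by (intro ceiling_unique) auto
    then show ?thesis by simp
  qed
  ultimately have "((\<lambda>s. h (real_of_int \<lceil>s / d\<rceil> * d)) has_integral (d * h (real (Suc m) * d))) {real m * d..real (Suc m) * d}"
    using has_integral_spike_interior by (metis (no_types, lifting) box_real(2))
  from has_integral_combine[OF _ _ Suc.IH this] d show ?case
    by simp
qed

text \<open>The filter \<open>at_right s\<close> excludes \<open>s\<close> itself, whereas the
  approximating points may hit \<open>s\<close> exactly; the limit is therefore proved directly,
  treating \<open>r n = s\<close> separately.\<close>

lemma right_continuous_tendsto_from_above:
  fixes h :: "real \<Rightarrow> real"
  assumes "continuous (at_right s) h" "\<And>n. s \<le> r n" "r \<longlonglongrightarrow> s"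
  shows "(\<lambda>n. h (r n)) \<longlonglongrightarrow> h s"
proof (rule LIMSEQ_I)
  fix e :: real assume "e > 0"
  then obtain d where d: "d > 0" "\<And>y. y > s \<Longrightarrow> dist y s < d \<Longrightarrow> dist (h y) (h s) < e"
    using assms(1) unfolding continuous_within_eps_delta by (metis greaterThan_iff)
  from assms(3) d(1) obtain N where N: "\<And>n. n \<ge> N \<Longrightarrow> dist (r n) s < d"
    unfolding lim_sequentially by blast
  have "norm (h (r n) - h s) < e" if "n \<ge> N" for n
    using d(2)[of "r n"] N[OF that] assms(2)[of n] \<open>e > 0\<close>
    by (cases "r n = s") (auto simp: dist_norm)
  then show "\<exists>N. \<forall>n\<ge>N. norm (h (r n) - h s) < e" by blast
qed

text \<open>The sums are integrals of step functions that converge pointwise to \<open>h\<close> and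
  are bounded by \<open>K\<close>. Dominated convergence for the gauge integral then yields
  integrability of \<open>h\<close> and the limit together.\<close>

lemma right_continuous_riemann_sum:
  fixes h :: "real \<Rightarrow> real"
  assumes cont: "\<And>s. s \<ge> 0 \<Longrightarrow> continuous (at_right s) h"
    and bnd: "\<And>s. \<bar>h s\<bar> \<le> K" and T: "T \<ge> 0"
  shows "h integrable_on {0..T}"
    and "(\<lambda>n. \<Sum>i=1..Suc n. T / real (Suc n) * h (real i * (T / real (Suc n)))) \<longlonglongrightarrow> integral {0..T} h"
proof -
  have "h integrable_on {0..T} \<and>
    (\<lambda>n. \<Sum>i=1..Suc n. T / real (Suc n) * h (real i * (T / real (Suc n)))) \<longlonglongrightarrow> integral {0..T} h"
  proof (cases "T = 0")
    case True
    then show ?thesis using integrable_on_refl[of h 0] by simp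
  next
    case False
    with T have T: "T > 0" by simp
    define d where "d = (\<lambda>n. T / real (Suc n))"
    have d: "d n > 0" and Td: "T = real (Suc n) * d n" for n
      using T by (auto simp: d_def)
    \<comment> \<open>The ceiling samples \<open>h\<close> at the right end of each mesh interval,
      so the sample point approaches \<open>s\<close> from above, which is the only side on which
      \<open>h\<close> is continuous.\<close>
    define q where "q = (\<lambda>n s. h (real_of_int \<lceil>s / d n\<rceil> * d n))"
    have q: "(q n has_integral (\<Sum>i=1..Suc n. d n * h (real i * d n))) {0..T}" for n
      using has_integral_ceiling_step[OF d, of h "n" "Suc n"] unfolding q_def Td[of n, symmetric] .
    have lim: "(\<lambda>n. q n s) \<longlonglongrightarrow> h s" if "s \<in> {0..T}" for s
      unfolding q_def
    proof (rule right_continuous_tendsto_from_above[where r = "\<lambda>n. real_of_int \<lceil>s / d n\<rceil> * d n"])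
      show "continuous (at_right s) h" using that cont by simp
      have lo: "s \<le> real_of_int \<lceil>s / d n\<rceil> * d n" for n
        using le_of_int_ceiling[of "s / d n"] d[of n] by (simp only: pos_divide_le_eq)
      then show "s \<le> real_of_int \<lceil>s / d n\<rceil> * d n" for n .
      have hi: "real_of_int \<lceil>s / d n\<rceil> * d n \<le> s + d n" for n
      proof -
        have "real_of_int \<lceil>s / d n\<rceil> \<le> s / d n + 1" by linarith
        then have "real_of_int \<lceil>s / d n\<rceil> * d n \<le> (s / d n + 1) * d n"
          using d[of n] by (intro mult_right_mono) auto
        then show ?thesis using d[of n] by (simp add: distrib_right)
      qed
      have "d \<longlonglongrightarrow> 0"
        unfolding d_def by (rule LIMSEQ_Suc[OF lim_const_over_n])
      then have "(\<lambda>n. s + d n) \<longlonglongrightarrow> s" using tendsto_add[OF tendsto_const, of d 0 _ s] by simp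
      then show "(\<lambda>n. real_of_int \<lceil>s / d n\<rceil> * d n) \<longlonglongrightarrow> s"
        by (rule tendsto_sandwich[OF _ _ tendsto_const, rotated 2]) (use lo hi in auto)
    qed
    have "h integrable_on {0..T}" "(\<lambda>n. integral {0..T} (q n)) \<longlonglongrightarrow> integral {0..T} h"
      by (rule dominated_convergence[of q "{0..T}" "\<lambda>_. K" h];
          use q lim bnd in \<open>auto simp: q_def has_integral_integrable\<close>; blast)+
    then show ?thesis
      using integral_unique[OF q] by (simp add: d_def)
  qed
  then show "h integrable_on {0..T}"
    and "(\<lambda>n. \<Sum>i=1..Suc n. T / real (Suc n) * h (real i * (T / real (Suc n)))) \<longlonglongrightarrow> integral {0..T} h"
    by blast+
qed

text \<open>Fekete's lemma in continuous time. The linear lower bound keeps the infimum finite;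
  nonpositivity disposes of the remainder \<open>a (t - n * T)\<close>, the place where boundedness
  on compact intervals is usually invoked.\<close>

lemma subadditive_tendsto_Inf:
  fixes a :: "real \<Rightarrow> real"
  assumes sub: "\<And>s t. 0 \<le> s \<Longrightarrow> 0 \<le> t \<Longrightarrow> a (s + t) \<le> a s + a t"
    and nonpos: "\<And>t. 0 \<le> t \<Longrightarrow> a t \<le> 0"
    and lower: "\<And>t. 0 \<le> t \<Longrightarrow> - K * t \<le> a t"
  shows "((\<lambda>t. a t / t) \<longlongrightarrow> (INF t\<in>{0<..}. a t / t)) at_top"
proof -
  define L where "L = (INF t\<in>{0<..}. a t / t)"
  have bdd: "bdd_below ((\<lambda>t. a t / t) ` {0<..})"
    by (rule bdd_belowI[of _ "-K"]) (use lower in \<open>auto simp: field_simps\<close>)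
  have ge: "L \<le> a t / t" if "t > 0" for t
    unfolding L_def using that by (intro cINF_lower bdd) auto
  have mult: "a (real n * T) \<le> real n * a T" if "T \<ge> 0" for n T
  proof (induction n)
    case 0
    then show ?case using nonpos[of 0] by simp
  next
    case (Suc n)
    then show ?case using sub[of "real n * T" T] that by (simp add: algebra_simps)
  qed
  have "\<forall>\<^sub>F t in at_top. a t / t < L + e" if "e > 0" for e
  proof -
    obtain T where T: "T > 0" "a T / T < L + e"
      using cINF_less_iff[OF _ bdd, of "L + e"] \<open>e > 0\<close> unfolding L_def[symmetric]
      by auto
    have up: "a t / t \<le> a T / T * (1 - T / t)" if "t > 0" for t
    proof -
      define n where "n = nat \<lfloor>t / T\<rfloor>"
      have n: "real n \<le> t / T" "t / T < real n + 1"
        unfolding n_def using that T by (auto simp: of_nat_nat)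
      then have n': "real n * T \<le> t" "t - T \<le> real n * T"
        using T by (auto simp: field_simps)
      have "a t \<le> a (real n * T) + a (t - real n * T)"
        using sub[of "real n * T" "t - real n * T"] n' T by simp
      also have "\<dots> \<le> real n * a T"
        using mult[of T n] nonpos[of "t - real n * T"] n' T by simp
      also have "\<dots> = a T / T * (real n * T)" using T by simp
      \<comment> \<open>The factor \<open>a T / T\<close> is nonpositive, so replacing
        \<open>n * T\<close> by the smaller \<open>t - T\<close> increases the product.\<close>
      also have "\<dots> \<le> a T / T * (t - T)"
        using n' T nonpos[of T] by (intro mult_left_mono_neg) (auto simp: divide_nonpos_pos)
      finally have "a t / t \<le> a T / T * (t - T) / t"
        using that by (intro divide_right_mono) auto
      also have "\<dots> = a T / T * (1 - T / t)" using that by (simp add: field_simps)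
      finally show ?thesis .
    qed
    have "((\<lambda>t. a T / T * (1 - T / t)) \<longlongrightarrow> a T / T * (1 - 0)) at_top"
      by (intro tendsto_intros tendsto_divide_0[OF tendsto_const] filterlim_at_top_imp_at_infinity filterlim_ident)
    then have "\<forall>\<^sub>F t in at_top. a T / T * (1 - T / t) < L + e"
      using T(2) by (intro order_tendstoD(2)) auto
    then show ?thesis
      using eventually_gt_at_top[of 0] by eventually_elim (use up in fastforce)
  qed
  then show ?thesis
    unfolding L_def[symmetric]
    by (intro order_tendstoI)
      (metis (no_types, lifting) eventually_mono[OF eventually_gt_at_top[of 0]] ge less_le_trans,
       metis add.commute diff_add_cancel diff_gt_0_iff_gt)
qed

lemma abs_prod_le_power:
  fixes k :: "'b \<Rightarrow> real"
  assumes "\<And>y. \<bar>k y\<bar> \<le> L"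
  shows "\<bar>\<Prod>i=1..n. k (z i)\<bar> \<le> L ^ n"
proof -
  have "\<bar>\<Prod>i=1..n. k (z i)\<bar> \<le> (\<Prod>i=1..n. L)"
    unfolding abs_prod by (rule prod_mono) (use assms in auto)
  then show ?thesis by simp
qed

text \<open>Removes \<open>LEAST\<close> and the infinite case from later arguments: exceeding
  \<open>n\<close> is a condition on finitely many positions, all observed by time
  \<open>n * \<delta>\<close>.\<close>

lemma less_exit_index_iff: "enat n < exit_index \<delta> X B v \<longleftrightarrow> (\<forall>j\<le>n. X (real j * \<delta>) v \<in> B)"
proof (cases "\<exists>k::nat. X (real k * \<delta>) v \<notin> B")
  case True
  define L where "L = (LEAST k::nat. X (real k * \<delta>) v \<notin> B)"
  have "X (real L * \<delta>) v \<notin> B" unfolding L_def using True by (rule LeastI_ex)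
  moreover have "X (real j * \<delta>) v \<in> B" if "j < L" for j
    using not_less_Least that unfolding L_def by blast
  moreover have "exit_index \<delta> X B v = enat L" using True by (simp add: exit_index_def L_def)
  ultimately show ?thesis by (metis enat_ord_simps(2) le_less_trans not_le)
qed (simp add: exit_index_def)

lemma exit_index_eqD:
  assumes "exit_index \<delta> X B v = enat n"
  shows "X (real n * \<delta>) v \<notin> B"
proof -
  have "\<not> enat n < exit_index \<delta> X B v" "\<And>j. j < n \<Longrightarrow> enat j < exit_index \<delta> X B v"
    using assms by auto
  then show ?thesis unfolding less_exit_index_iff by (metis le_neq_implies_less order_refl)
qed

text \<open>If the exit from \<open>B\<close> came first, the path at that time would still be in
  \<open>A\<close> and yet outside \<open>B\<close>. This later compares the optimal time with the
  exit from \<open>B\<close>.\<close>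

lemma exit_index_mono: "A \<subseteq> B \<Longrightarrow> exit_index \<delta> X A v \<le> exit_index \<delta> X B v"
proof (rule ccontr)
  assume AB: "A \<subseteq> B" and "\<not> exit_index \<delta> X A v \<le> exit_index \<delta> X B v"
  then obtain n where n: "exit_index \<delta> X B v = enat n" "enat n < exit_index \<delta> X A v"
    by (cases "exit_index \<delta> X B v") auto
  from n(2) have "X (real n * \<delta>) v \<in> A" by (simp add: less_exit_index_iff)
  with exit_index_eqD[OF n(1)] AB show False by auto
qed

text \<open>A supremum of continuous functions is lower semicontinuous: its strict superlevel sets
  are unions of open sets, so the possibly uncountable index set \<open>U\<close> does no
  harm.\<close>

lemma Mop_measurable:
  fixes c :: "'a::metric_space \<Rightarrow> 'a \<Rightarrow> real"
  assumes "U \<noteq> {}" and c: "continuous_on (UNIV \<times> U) (\<lambda>(x, \<xi>). c x \<xi>)"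
    and bnd: "\<And>x \<xi>. \<xi> \<in> U \<Longrightarrow> c x \<xi> + w \<xi> \<le> K"
  shows "Mop c U w \<in> borel_measurable borel"
  unfolding borel_measurable_iff_greater
proof
  fix a :: real
  have bdd: "bdd_above ((\<lambda>\<xi>. c x \<xi> + w \<xi>) ` U)" for x
    using bnd by (auto intro!: bdd_aboveI)
  have "open {x. a < c x \<xi> + w \<xi>}" if "\<xi> \<in> U" for \<xi>
  proof -
    have "continuous_on UNIV (\<lambda>x. (\<lambda>(x, \<xi>). c x \<xi>) (x, \<xi>))"
      by (rule continuous_on_compose2[OF c]) (use that in \<open>auto intro!: continuous_intros\<close>)
    then have "continuous_on UNIV (\<lambda>x. c x \<xi> + w \<xi>)"
      by (intro continuous_on_add continuous_on_const) simp
    then show ?thesis by (intro open_Collect_less continuous_on_const)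
  qed
  moreover have "{x. a < Mop c U w x} = (\<Union>\<xi>\<in>U. {x. a < c x \<xi> + w \<xi>})"
    unfolding Mop_def using less_cSUP_iff[OF \<open>U \<noteq> {}\<close> bdd] by auto
  ultimately show "{x \<in> space borel. a < Mop c U w x} \<in> sets borel"
    by (auto intro!: borel_open open_UN)
qed

lemma abs_Mop_le:
  assumes "U \<noteq> {}" and "\<And>\<xi>. \<xi> \<in> U \<Longrightarrow> \<bar>c x \<xi> + w \<xi>\<bar> \<le> K"
  shows "\<bar>Mop c U w x\<bar> \<le> K"
proof -
  obtain \<xi> where \<xi>: "\<xi> \<in> U" using \<open>U \<noteq> {}\<close> by blast
  have "bdd_above ((\<lambda>\<xi>. c x \<xi> + w \<xi>) ` U)"
    using abs_le_D1[OF assms(2)] by (auto intro!: bdd_aboveI)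
  then have "c x \<xi> + w \<xi> \<le> Mop c U w x"
    unfolding Mop_def using \<xi> by (intro cSUP_upper)
  moreover have "Mop c U w x \<le> K"
    unfolding Mop_def using abs_le_D1[OF assms(2)] \<open>U \<noteq> {}\<close> by (intro cSUP_least)
  ultimately show ?thesis using assms(2)[OF \<xi>] by linarith
qed

subsection \<open>The Markov property for exponential path functionals\<close>

locale feller_markov_process =
  fixes Omega :: "'w measure" and P :: "'a::{metric_space,second_countable_topology} \<Rightarrow> 'w measure"
    and F :: "real \<Rightarrow> 'w set set" and X :: "real \<Rightarrow> 'w \<Rightarrow> 'a"
  assumes proc: "standard_feller_markov Omega P F X"
begin

lemma prob_space_law: "prob_space (P x)"
  and sets_law [measurable_cong, simp]: "sets (P x) = sets Omega"
  using proc unfolding standard_feller_markov_def by (auto simp: all_conj_distrib)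

lemma space_law [simp]: "space (P x) = space Omega"
  using sets_eq_imp_space_eq[OF sets_law] .

text \<open>Presents the laws as a kernel, so that expectations of a fixed random variable become
  Borel functions of the starting point.\<close>

lemma law_measurable [measurable]: "P \<in> borel \<rightarrow>\<^sub>M subprob_algebra Omega"
proof (rule measurable_subprob_algebra)
  show "subprob_space (P x)" for x
    by (rule prob_space_imp_subprob_space[OF prob_space_law])
  show "(\<lambda>x. emeasure (P x) A) \<in> borel_measurable borel" if "A \<in> sets Omega" for A
    using proc that unfolding standard_feller_markov_def by blast
qed simp

lemma filtration: "filtration_on Omega F"
  using proc unfolding standard_feller_markov_def by blast

lemma sigma_algebra_F: "0 \<le> t \<Longrightarrow> sigma_algebra (space Omega) (F t)"
  using filtration unfolding filtration_on_def by blast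

text \<open>Packages the set system \<open>F t\<close> as a measure space, the form expected by
  measurability statements and conditional expectations. For \<open>t \<ge> 0\<close> no sets are
  added.\<close>

definition Fm :: "real \<Rightarrow> 'w measure" where
  "Fm t = sigma (space Omega) (F t)"

lemma space_Fm [simp]: "space (Fm t) = space Omega"
  by (simp add: Fm_def space_measure_of_conv)

lemma sets_Fm: "t \<ge> 0 \<Longrightarrow> sets (Fm t) = F t"
  using filtration unfolding Fm_def filtration_on_def
  by (metis sigma_algebra.sets_measure_of_eq)

lemma F_mono: "0 \<le> s \<Longrightarrow> s \<le> t \<Longrightarrow> F s \<subseteq> F t"
  using filtration unfolding filtration_on_def by blast

lemma F_subset: "0 \<le> t \<Longrightarrow> F t \<subseteq> sets Omega"
  using filtration unfolding filtration_on_def by blast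

lemma subalgebra_law: "0 \<le> t \<Longrightarrow> subalgebra (P x) (Fm t)"
  using F_subset by (simp add: subalgebra_def sets_Fm)

lemma measurable_Fm_mono: "f \<in> Fm s \<rightarrow>\<^sub>M N \<Longrightarrow> 0 \<le> s \<Longrightarrow> s \<le> t \<Longrightarrow> f \<in> Fm t \<rightarrow>\<^sub>M N"
  using F_mono[of s t] by (auto simp: measurable_def sets_Fm)

lemma measurable_Fm_Omega: "f \<in> Fm s \<rightarrow>\<^sub>M N \<Longrightarrow> 0 \<le> s \<Longrightarrow> f \<in> Omega \<rightarrow>\<^sub>M N"
  using F_subset[of s] by (auto simp: measurable_def sets_Fm)

lemma X_adapted: "0 \<le> s \<Longrightarrow> s \<le> t \<Longrightarrow> X s \<in> Fm t \<rightarrow>\<^sub>M borel"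
proof (rule measurable_Fm_mono[of _ s])
  assume s: "0 \<le> s"
  then show "X s \<in> Fm s \<rightarrow>\<^sub>M borel"
    using proc sets_Fm[OF s] unfolding standard_feller_markov_def measurable_def
    by (auto simp: vimage_def Int_def conj_commute)
qed

lemma X_measurable: "0 \<le> t \<Longrightarrow> X t \<in> Omega \<rightarrow>\<^sub>M borel"
  using proc unfolding standard_feller_markov_def by blast

lemma AE_start: "AE v in P x. X 0 v = x"
proof -
  interpret prob_space "P x" by (rule prob_space_law)
  have "prob {v \<in> space (P x). X 0 v = x} = 1"
    using proc unfolding standard_feller_markov_def by simp
  then show ?thesis
    using AE_in_set_eq_1[of "{v \<in> space (P x). X 0 v = x}"] X_measurable[of 0]
    by (auto simp: measurable_cong_sets[OF sets_law refl])
qed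

lemma right_continuous_path: "v \<in> space Omega \<Longrightarrow> 0 \<le> t \<Longrightarrow> continuous (at_right t) (\<lambda>s. X s v)"
  using proc unfolding standard_feller_markov_def by blast

lemma integrable_law_bounded:
  fixes g :: "'w \<Rightarrow> real"
  assumes "g \<in> borel_measurable Omega" "\<And>v. v \<in> space Omega \<Longrightarrow> \<bar>g v\<bar> \<le> C"
  shows "integrable (P x) g"
proof -
  interpret prob_space "P x" by (rule prob_space_law)
  show ?thesis
    by (rule integrable_const_bound[of _ C])
      (use assms in \<open>auto simp: measurable_cong_sets[OF sets_law refl]\<close>)
qed

lemma abs_integral_law_le:
  fixes g :: "'w \<Rightarrow> real"
  assumes "g \<in> borel_measurable Omega" "\<And>v. v \<in> space Omega \<Longrightarrow> \<bar>g v\<bar> \<le> C"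
  shows "\<bar>\<integral>v. g v \<partial>P x\<bar> \<le> C"
proof -
  interpret prob_space "P x" by (rule prob_space_law)
  have int: "integrable (P x) g" using integrable_law_bounded assms by blast
  have "\<bar>\<integral>v. g v \<partial>P x\<bar> \<le> (\<integral>v. \<bar>g v\<bar> \<partial>P x)"
    by (rule integral_abs_bound)
  also have "\<dots> \<le> (\<integral>v. C \<partial>P x)"
    using int assms(2) by (intro integral_mono) auto
  finally show ?thesis using prob_space by simp
qed

lemma integral_law_measurable:
  fixes g :: "'w \<Rightarrow> real"
  assumes "g \<in> borel_measurable Omega"
  shows "(\<lambda>x. \<integral>v. g v \<partial>P x) \<in> borel_measurable borel"
  by (rule measurable_compose[OF law_measurable integral_measurable_subprob_algebra[OF assms]])

text \<open>The strong Markov axiom at the constant stopping time \<open>t\<close>; what has to be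
  checked is that events of \<open>F t\<close> lie in the sigma-algebra of the past of this
  time.\<close>

lemma markov_set:
  fixes g :: "'a \<Rightarrow> real"
  assumes t: "0 \<le> t" and s: "0 \<le> s" and A: "A \<in> F t"
    and g: "g \<in> borel_measurable borel" "bounded (range g)"
  shows "(\<integral>v. indicator A v * g (X (t + s) v) \<partial>P x) =
    (\<integral>v. indicator A v * (\<integral>u. g (X s u) \<partial>P (X t v)) \<partial>P x)"
proof -
  have st: "stopping_time_on Omega F (\<lambda>_. ennreal t)"
    unfolding stopping_time_on_def
  proof (intro allI impI)
    fix u :: real assume "0 \<le> u"
    then interpret sigma_algebra "space Omega" "F u" by (rule sigma_algebra_F)
    show "{w \<in> space Omega. ennreal t \<le> ennreal u} \<in> F u"
      by (cases "ennreal t \<le> ennreal u") auto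
  qed
  have "A \<in> pre_stopping_sigma Omega F (\<lambda>_. ennreal t)"
    unfolding pre_stopping_sigma_def
  proof (intro CollectI conjI allI impI)
    show "A \<in> sets Omega" using A F_subset t by blast
    then have sub: "A \<subseteq> space Omega" by (rule sets.sets_into_space)
    fix u :: real assume u: "0 \<le> u"
    then interpret sigma_algebra "space Omega" "F u" by (rule sigma_algebra_F)
    show "A \<inter> {w \<in> space Omega. ennreal t \<le> ennreal u} \<in> F u"
    proof (cases "t \<le> u")
      case True
      then have "A \<inter> {w \<in> space Omega. ennreal t \<le> ennreal u} = A"
        using sub by (auto intro: ennreal_leI)
      then show ?thesis using A F_mono[OF t True] by auto
    next
      case False
      then have "A \<inter> {w \<in> space Omega. ennreal t \<le> ennreal u} = {}"
        using u by (auto simp: ennreal_le_iff)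
      then show ?thesis by simp
    qed
  qed
  moreover have "\<forall>x T A s (g::'a \<Rightarrow> real).
        stopping_time_on Omega F T \<and> A \<in> pre_stopping_sigma Omega F T \<and> s \<ge> 0 \<and>
        g \<in> borel_measurable borel \<and> bounded (range g) \<longrightarrow>
        (\<integral>w. indicator (A \<inter> {w. T w < \<infinity>}) w * g (X (enn2real (T w) + s) w) \<partial>P x) =
        (\<integral>w. indicator (A \<inter> {w. T w < \<infinity>}) w *
               (\<integral>v. g (X s v) \<partial>P (X (enn2real (T w)) w)) \<partial>P x)"
    using proc unfolding standard_feller_markov_def by blast
  ultimately have "(\<integral>w. indicator (A \<inter> {w. ennreal t < \<infinity>}) w * g (X (enn2real (ennreal t) + s) w) \<partial>P x) =
        (\<integral>w. indicator (A \<inter> {w. ennreal t < \<infinity>}) w *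
               (\<integral>v. g (X s v) \<partial>P (X (enn2real (ennreal t)) w)) \<partial>P x)"
    using st s g by blast
  then show ?thesis using t by simp
qed

text \<open>The identity on events characterises \<open>G (X t v)\<close> as the conditional
  expectation of \<open>g (X (t + s) v)\<close> given \<open>F t\<close>; a bounded
  \<open>F t\<close>-measurable factor \<open>Y\<close> can then be pulled in and out.\<close>

lemma markov_one_time:
  fixes g :: "'a \<Rightarrow> real"
  assumes t: "0 \<le> t" and s: "0 \<le> s"
    and Y: "Y \<in> borel_measurable (Fm t)" "\<And>v. v \<in> space Omega \<Longrightarrow> \<bar>Y v\<bar> \<le> C"
    and g: "g \<in> borel_measurable borel" "\<And>y. \<bar>g y\<bar> \<le> K"
  shows "(\<integral>v. Y v * g (X (t + s) v) \<partial>P x) = (\<integral>v. Y v * (\<integral>u. g (X s u) \<partial>P (X t v)) \<partial>P x)"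
proof -
  interpret prob_space "P x" by (rule prob_space_law)
  interpret finite_measure_subalgebra "P x" "Fm t"
    by unfold_locales (rule subalgebra_law[OF t])
  define G where "G = (\<lambda>y. \<integral>u. g (X s u) \<partial>P y)"
  have bg: "bounded (range g)" using g(2) by (auto simp: bounded_iff)
  have gm: "(\<lambda>v. g (X r v)) \<in> borel_measurable Omega" if "0 \<le> r" for r
    by (rule measurable_compose[OF X_measurable[OF that] g(1)])
  have Gm: "G \<in> borel_measurable borel"
    unfolding G_def by (rule integral_law_measurable[OF gm[OF s]])
  have GK: "\<bar>G y\<bar> \<le> K" for y
    unfolding G_def by (rule abs_integral_law_le[OF gm[OF s]]) (rule g(2))
  have GXF: "(\<lambda>v. G (X t v)) \<in> borel_measurable (Fm t)"
    by (rule measurable_compose[OF X_adapted[OF t order_refl] Gm])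
  have GX: "(\<lambda>v. G (X t v)) \<in> borel_measurable Omega"
    by (rule measurable_Fm_Omega[OF GXF t])
  have YO: "Y \<in> borel_measurable Omega" by (rule measurable_Fm_Omega[OF Y(1) t])
  have gts: "(\<lambda>v. g (X (t + s) v)) \<in> borel_measurable Omega" using gm[of "t + s"] t s by simp
  have "AE v in P x. real_cond_exp (P x) (Fm t) (\<lambda>v. g (X (t + s) v)) v = G (X t v)"
  proof (rule real_cond_exp_charact)
    show "integrable (P x) (\<lambda>v. g (X (t + s) v))"
      by (rule integrable_law_bounded[OF gts]) (rule g(2))
    show "integrable (P x) (\<lambda>v. G (X t v))"
      by (rule integrable_law_bounded[OF GX]) (rule GK)
    show "(\<lambda>v. G (X t v)) \<in> borel_measurable (Fm t)" by (rule GXF)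
    show "(\<integral>v\<in>A. g (X (t + s) v) \<partial>P x) = (\<integral>v\<in>A. G (X t v) \<partial>P x)" if "A \<in> sets (Fm t)" for A
      using markov_set[OF t s _ g(1) bg, of A] that t
      by (simp add: set_lebesgue_integral_def G_def sets_Fm)
  qed
  then have "(\<integral>v. Y v * real_cond_exp (P x) (Fm t) (\<lambda>v. g (X (t + s) v)) v \<partial>P x) = (\<integral>v. Y v * G (X t v) \<partial>P x)"
    by (intro integral_cong_AE)
      (use YO GX in \<open>auto simp: measurable_cong_sets[OF sets_law refl] intro!: borel_measurable_times\<close>)
  moreover have "(\<integral>v. Y v * real_cond_exp (P x) (Fm t) (\<lambda>v. g (X (t + s) v)) v \<partial>P x)
    = (\<integral>v. Y v * g (X (t + s) v) \<partial>P x)"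
  proof (rule real_cond_exp_intg(2))
    show "integrable (P x) (\<lambda>v. Y v * g (X (t + s) v))"
    proof (rule integrable_law_bounded[of _ "C * K"])
      show "\<bar>Y v * g (X (t + s) v)\<bar> \<le> C * K" if "v \<in> space Omega" for v
        using Y(2)[OF that] g(2)[of "X (t + s) v"] by (simp add: abs_mult mult_mono')
    qed (use YO gts in auto)
  qed (use Y gts in \<open>auto simp: measurable_cong_sets[OF sets_law refl]\<close>)
  ultimately show ?thesis by (simp add: G_def)
qed

text \<open>A discrete Feynman-Kac operator: multiply by the weight \<open>k\<close>, then apply the
  transition operator over time \<open>h\<close>.\<close>

definition step_op :: "('a \<Rightarrow> real) \<Rightarrow> real \<Rightarrow> ('a \<Rightarrow> real) \<Rightarrow> 'a \<Rightarrow> real" where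
  "step_op k h g y = (\<integral>u. k (X h u) * g (X h u) \<partial>P y)"

lemma prod_X_adapted:
  assumes "0 \<le> t" "0 \<le> h" "t + real n * h \<le> r" and k: "k \<in> borel_measurable borel"
  shows "(\<lambda>v. \<Prod>i=1..n. k (X (t + real i * h) v) :: real) \<in> borel_measurable (Fm r)"
proof (rule borel_measurable_prod)
  fix i assume "i \<in> {1..n}"
  then have "t + real i * h \<le> t + real n * h" using assms(2) by (simp add: mult_right_mono)
  with assms show "(\<lambda>v. k (X (t + real i * h) v)) \<in> borel_measurable (Fm r)"
    by (intro measurable_compose[OF X_adapted k]) auto
qed

text \<open>Conditioning at the last but one time turns the final factors into one application of
  \<open>step_op\<close>, while the earlier factors are absorbed into the bounded past variable.
  Since this changes \<open>g\<close> and its bound, both are generalised in the induction.\<close>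

lemma markov_product_iterate:
  fixes g k :: "'a \<Rightarrow> real"
  assumes t: "0 \<le> t" and h: "0 \<le> h"
    and Y: "Y \<in> borel_measurable (Fm t)" "\<And>v. v \<in> space Omega \<Longrightarrow> \<bar>Y v\<bar> \<le> C"
    and k: "k \<in> borel_measurable borel" "\<And>y. \<bar>k y\<bar> \<le> L"
    and g: "g \<in> borel_measurable borel" "\<And>y. \<bar>g y\<bar> \<le> K"
  shows "(\<integral>v. Y v * ((\<Prod>i=1..n. k (X (t + real i * h) v)) * g (X (t + real n * h) v)) \<partial>P x) =
    (\<integral>v. Y v * (step_op k h ^^ n) g (X t v) \<partial>P x)"
  using g
proof (induction n arbitrary: g K)
  case 0
  then show ?case by simp
next
  case (Suc n)
  have kg: "(\<lambda>y. k y * g y) \<in> borel_measurable borel" using k(1) Suc.prems(1) by measurable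
  have kgb: "\<bar>k y * g y\<bar> \<le> L * K" for y
    using k(2)[of y] Suc.prems(2)[of y] by (simp add: abs_mult mult_mono')
  have tn: "0 \<le> t + real n * h" using t h by simp
  have "(\<integral>v. Y v * ((\<Prod>i=1..Suc n. k (X (t + real i * h) v)) * g (X (t + real (Suc n) * h) v)) \<partial>P x)
    = (\<integral>v. (Y v * (\<Prod>i=1..n. k (X (t + real i * h) v))) * (k (X (t + real n * h + h) v) * g (X (t + real n * h + h) v)) \<partial>P x)"
    by (simp add: algebra_simps)
  also have "\<dots> = (\<integral>v. (Y v * (\<Prod>i=1..n. k (X (t + real i * h) v))) * (\<integral>u. k (X h u) * g (X h u) \<partial>P (X (t + real n * h) v)) \<partial>P x)"
  proof (rule markov_one_time[OF tn h _ _ kg kgb])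
    show "(\<lambda>v. Y v * (\<Prod>i=1..n. k (X (t + real i * h) v))) \<in> borel_measurable (Fm (t + real n * h))"
      using prod_X_adapted[OF t h order_refl k(1), of n] measurable_Fm_mono[OF Y(1) t, of "t + real n * h"] h
      by (intro borel_measurable_times) auto
    show "\<bar>Y v * (\<Prod>i=1..n. k (X (t + real i * h) v))\<bar> \<le> C * L ^ n" if "v \<in> space Omega" for v
      using Y(2)[OF that] abs_prod_le_power[of k L "\<lambda>i. X (t + real i * h) v" n, OF k(2)]
      by (simp add: abs_mult mult_mono')
  qed
  also have "\<dots> = (\<integral>v. Y v * ((\<Prod>i=1..n. k (X (t + real i * h) v)) * step_op k h g (X (t + real n * h) v)) \<partial>P x)"
    by (simp add: step_op_def mult.assoc)
  \<comment> \<open>The induction hypothesis is used for \<open>step_op k h g\<close>, which is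
    again measurable and is bounded by \<open>L * K\<close>.\<close>
  also have "\<dots> = (\<integral>v. Y v * (step_op k h ^^ n) (step_op k h g) (X t v) \<partial>P x)"
  proof (rule Suc.IH)
    have m: "(\<lambda>u. k (X h u) * g (X h u)) \<in> borel_measurable Omega"
      by (rule measurable_compose[OF X_measurable[OF h] kg])
    show "step_op k h g \<in> borel_measurable borel"
      unfolding step_op_def by (rule integral_law_measurable[OF m])
    show "\<bar>step_op k h g y\<bar> \<le> L * K" for y
      unfolding step_op_def by (rule abs_integral_law_le[OF m]) (rule kgb)
  qed
  also have "\<dots> = (\<integral>v. Y v * (step_op k h ^^ Suc n) g (X t v) \<partial>P x)"
    by (simp add: funpow_Suc_right del: funpow.simps)
  finally show ?case .
qed

text \<open>Both sides reduce to powers of \<open>step_op\<close>. The inner expectation is the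
  iterated formula at time \<open>0\<close> with \<open>Y = 1\<close>, because
  \<open>X 0 = y\<close> almost surely under \<open>P y\<close>.\<close>

lemma markov_product:
  fixes g k :: "'a \<Rightarrow> real"
  assumes t: "0 \<le> t" and h: "0 \<le> h"
    and Y: "Y \<in> borel_measurable (Fm t)" "\<And>v. v \<in> space Omega \<Longrightarrow> \<bar>Y v\<bar> \<le> C"
    and k: "k \<in> borel_measurable borel" "\<And>y. \<bar>k y\<bar> \<le> L"
    and g: "g \<in> borel_measurable borel" "\<And>y. \<bar>g y\<bar> \<le> K"
  shows "(\<integral>v. Y v * ((\<Prod>i=1..n. k (X (t + real i * h) v)) * g (X (t + real n * h) v)) \<partial>P x) =
    (\<integral>v. Y v * (\<integral>u. (\<Prod>i=1..n. k (X (real i * h) u)) * g (X (real n * h) u) \<partial>P (X t v)) \<partial>P x)"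
proof -
  have "(\<integral>u. (\<Prod>i=1..n. k (X (real i * h) u)) * g (X (real n * h) u) \<partial>P y) = (step_op k h ^^ n) g y" for y
  proof -
    interpret prob_space "P y" by (rule prob_space_law)
    have "(\<integral>u. (\<Prod>i=1..n. k (X (real i * h) u)) * g (X (real n * h) u) \<partial>P y)
      = (\<integral>u. (step_op k h ^^ n) g (X 0 u) \<partial>P y)"
      using markov_product_iterate[OF order_refl h _ _ k g, where Y = "\<lambda>_. 1" and C = 1 and n = n and x = y] by simp
    also have "\<dots> = (\<integral>u. (step_op k h ^^ n) g y \<partial>P y)"
    proof (rule integral_cong_AE)
      have meas: "(step_op k h ^^ n) g \<in> borel_measurable borel"
        using g
      proof (induction n)
        case (Suc n)
        have "(\<lambda>u. k (X h u) * (step_op k h ^^ n) g (X h u)) \<in> borel_measurable Omega"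
          using k(1) Suc X_measurable[OF h] by (intro borel_measurable_times measurable_compose[OF X_measurable[OF h]]) auto
        from integral_law_measurable[OF this] show ?case
          by (simp add: step_op_def[abs_def])
      qed simp
      show "(\<lambda>u. (step_op k h ^^ n) g (X 0 u)) \<in> borel_measurable (P y)"
        using measurable_compose[OF X_measurable[OF order_refl] meas]
        by (simp add: measurable_cong_sets[OF sets_law refl])
      show "AE u in P y. (step_op k h ^^ n) g (X 0 u) = (step_op k h ^^ n) g y"
        using AE_start[of y] by eventually_elim simp
    qed simp
    also have "\<dots> = (step_op k h ^^ n) g y" using prob_space by simp
    finally show ?thesis .
  qed
  then show ?thesis
    using markov_product_iterate[OF t h Y k g] by simp
qed

section \<open>Additive functionals along right-continuous paths\<close>

context
  fixes f :: "'a \<Rightarrow> real" and K :: real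
  assumes f_cont: "continuous_on UNIV f" and f_bnd: "\<And>y. \<bar>f y\<bar> \<le> K"
begin

lemma right_continuous_along_path:
  assumes v: "v \<in> space Omega" and "0 \<le> t" "0 \<le> s"
  shows "continuous (at_right s) (\<lambda>u. f (X (t + u) v))"
proof -
  have "((\<lambda>u. X u v) \<longlongrightarrow> X (t + s) v) (at_right (t + s))"
    using right_continuous_path[OF v, of "t + s"] assms by (simp add: continuous_within)
  moreover have "filterlim (\<lambda>u. t + u) (at_right (t + s)) (at_right s)"
    by (auto simp: filterlim_at eventually_at_filter intro!: tendsto_intros)
  ultimately have "((\<lambda>u. X (t + u) v) \<longlongrightarrow> X (t + s) v) (at_right s)"
    by (rule filterlim_compose)
  moreover have "isCont f (X (t + s) v)"
    using f_cont by (simp add: continuous_on_eq_continuous_at)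
  ultimately have "((\<lambda>u. f (X (t + u) v)) \<longlongrightarrow> f (X (t + s) v)) (at_right s)"
    by (rule isCont_tendsto_compose[rotated])
  then show ?thesis by (simp add: continuous_within)
qed

text \<open>The shift \<open>t\<close> covers both the path from time \<open>0\<close> and the
  future after a conditioning time. No sign is imposed on \<open>f\<close>, so the results apply to
  the cost with and without the discount \<open>lam\<close>.\<close>

lemma along_path_integral:
  assumes v: "v \<in> space Omega" and t: "0 \<le> t" and s: "0 \<le> s"
  shows "(\<lambda>u. f (X (t + u) v)) integrable_on {0..s}"
    and "(\<lambda>n. \<Sum>i=1..Suc n. s / real (Suc n) * f (X (t + real i * (s / real (Suc n))) v))
      \<longlonglongrightarrow> integral {0..s} (\<lambda>u. f (X (t + u) v))"
    and "\<bar>integral {0..s} (\<lambda>u. f (X (t + u) v))\<bar> \<le> K * s"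
proof -
  note rs = right_continuous_riemann_sum[of "\<lambda>u. f (X (t + u) v)" K s,
      OF right_continuous_along_path[OF v t] f_bnd s]
  show *: "(\<lambda>u. f (X (t + u) v)) integrable_on {0..s}" by (rule rs(1))
  show "(\<lambda>n. \<Sum>i=1..Suc n. s / real (Suc n) * f (X (t + real i * (s / real (Suc n))) v))
      \<longlonglongrightarrow> integral {0..s} (\<lambda>u. f (X (t + u) v))" by (rule rs(2))
  show "\<bar>integral {0..s} (\<lambda>u. f (X (t + u) v))\<bar> \<le> K * s"
    using has_integral_bound_real[of K "{}" "\<lambda>u. f (X (t + u) v)" _ 0 s] s f_bnd
      integrable_integral[OF *] order_trans[OF abs_ge_zero f_bnd]
    by auto
qed

lemma path_int_bound: "v \<in> space Omega \<Longrightarrow> 0 \<le> s \<Longrightarrow> \<bar>path_int X f s v\<bar> \<le> K * s"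
  using along_path_integral(3)[of v 0 s] by (simp add: path_int_def)

lemma path_int_add:
  assumes v: "v \<in> space Omega" and t: "0 \<le> t" and s: "0 \<le> s"
  shows "path_int X f (t + s) v = path_int X f t v + integral {0..s} (\<lambda>u. f (X (t + u) v))"
proof -
  have "integral {0..t + s} (\<lambda>u. f (X u v)) = integral {0..t} (\<lambda>u. f (X u v)) + integral {t..t + s} (\<lambda>u. f (X u v))"
    using Henstock_Kurzweil_Integration.integral_combine[of 0 t "t + s" "\<lambda>u. f (X u v)"]
      along_path_integral(1)[OF v order_refl, of "t + s"] t s by simp
  moreover have "integral {t..t + s} (\<lambda>u. f (X u v)) = integral {0..s} (\<lambda>u. f (X (t + u) v))"
    using integral_shift_Icc_real[of 0 s "\<lambda>u. f (X u v)" t] by (simp add: o_def add.commute)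
  ultimately show ?thesis by (simp add: path_int_def)
qed

text \<open>The integral is a pointwise limit of Riemann sums whose nodes do not exceed
  \<open>t\<close>. The summand \<open>0 +\<close> only matches the shifted form of the convergence
  statement.\<close>

lemma path_int_adapted:
  assumes t: "0 \<le> t"
  shows "path_int X f t \<in> borel_measurable (Fm t)"
proof (rule borel_measurable_LIMSEQ_real)
  show "(\<lambda>n. \<Sum>i=1..Suc n. t / real (Suc n) * f (X (0 + real i * (t / real (Suc n))) v)) \<longlonglongrightarrow> path_int X f t v"
    if "v \<in> space (Fm t)" for v
    using along_path_integral(2)[of v 0 t] that t by (simp add: path_int_def)
  show "(\<lambda>v. \<Sum>i=1..Suc n. t / real (Suc n) * f (X (0 + real i * (t / real (Suc n))) v)) \<in> borel_measurable (Fm t)" for n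
  proof (intro borel_measurable_sum borel_measurable_times borel_measurable_const)
    fix i assume "i \<in> {1..Suc n}"
    then have "real i * t \<le> real (Suc n) * t" using t by (intro mult_right_mono) auto
    then have "0 + real i * (t / real (Suc n)) \<le> t" by (simp add: field_simps)
    then show "(\<lambda>v. f (X (0 + real i * (t / real (Suc n))) v)) \<in> borel_measurable (Fm t)"
      using t f_cont by (intro measurable_compose[OF X_adapted borel_measurable_continuous_onI]) auto
  qed
qed

lemma path_int_measurable: "0 \<le> t \<Longrightarrow> path_int X f t \<in> borel_measurable Omega"
  using path_int_adapted measurable_Fm_Omega by blast

text \<open>The exponential of a Riemann sum is a product over grid points, for which the Markov
  property is known. Refining the grid, dominated convergence applies to the left side, to the inner
  expectation, and then to the right side.\<close>

lemma markov_path: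
  fixes g :: "'a \<Rightarrow> real"
  assumes t: "0 \<le> t" and s: "0 \<le> s"
    and Y: "Y \<in> borel_measurable (Fm t)" "\<And>v. v \<in> space Omega \<Longrightarrow> \<bar>Y v\<bar> \<le> C"
    and g: "g \<in> borel_measurable borel" "\<And>y. \<bar>g y\<bar> \<le> M"
  shows "(\<integral>v. Y v * (exp (integral {0..s} (\<lambda>u. f (X (t + u) v))) * g (X (t + s) v)) \<partial>P x) =
    (\<integral>v. Y v * (\<integral>u. exp (path_int X f s u) * g (X s u) \<partial>P (X t v)) \<partial>P x)"
proof -
  define h where "h = (\<lambda>n. s / real (Suc n))"
  \<comment> \<open>The offset \<open>r\<close> is \<open>t\<close> for the shifted path on the left
    side and \<open>0\<close> for the restarted process on the right.\<close>
  define E where "E = (\<lambda>r n v. (\<Prod>i=1..Suc n. exp (h n * f (X (r + real i * h n) v))))"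
  have h: "0 \<le> h n" and hs: "real (Suc n) * h n = s" for n using s by (auto simp: h_def)
  have f_meas: "f \<in> borel_measurable borel" using f_cont by (rule borel_measurable_continuous_onI)
  have E_exp: "E r n v = exp (\<Sum>i=1..Suc n. s / real (Suc n) * f (X (r + real i * (s / real (Suc n))) v))" for r n v
    unfolding E_def h_def by (rule exp_sum[symmetric]) simp
  have E_lim: "(\<lambda>n. E r n v) \<longlonglongrightarrow> exp (integral {0..s} (\<lambda>u. f (X (r + u) v)))"
    if "v \<in> space Omega" "0 \<le> r" for r v
    unfolding E_exp by (intro tendsto_exp along_path_integral(2) that s)
  have E_bound: "\<bar>E r n v\<bar> \<le> exp (K * s)" for r n v
  proof -
    have "(\<Sum>i=1..Suc n. h n * f (X (r + real i * h n) v)) \<le> (\<Sum>i=1..Suc n. h n * K)"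
      by (intro sum_mono mult_left_mono h order_trans[OF abs_ge_self f_bnd])
    also have "\<dots> = K * (real (Suc n) * h n)" by (simp add: mult_ac)
    finally show ?thesis unfolding E_exp using hs[of n] by (simp add: h_def)
  qed
  have E_meas: "E r n \<in> borel_measurable Omega" if "0 \<le> r" for r n
  proof -
    have k: "(\<lambda>y. exp (h n * f y)) \<in> borel_measurable borel" using f_meas by measurable
    have "E r n \<in> borel_measurable (Fm (r + real (Suc n) * h n))"
      unfolding E_def by (rule prod_X_adapted[OF that h order_refl k])
    then show ?thesis by (rule measurable_Fm_Omega) (use that hs[of n] s in simp)
  qed
  have gX: "(\<lambda>v. g (X r v)) \<in> borel_measurable Omega" if "0 \<le> r" for r
    by (rule measurable_compose[OF X_measurable[OF that] g(1)])
  have YO: "Y \<in> borel_measurable Omega" by (rule measurable_Fm_Omega[OF Y(1) t])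
  have EgM: "\<bar>E r n v * z\<bar> \<le> exp (K * s) * M" if "\<bar>z\<bar> \<le> M" for r n v z
    using E_bound[of r n v] that by (simp add: abs_mult mult_mono')
  define \<phi> where "\<phi> = (\<lambda>n y. \<integral>u. E 0 n u * g (X s u) \<partial>P y)"
  define \<psi> where "\<psi> = (\<lambda>y. \<integral>u. exp (path_int X f s u) * g (X s u) \<partial>P y)"
  have \<phi>_int_meas: "(\<lambda>u. E 0 n u * g (X s u)) \<in> borel_measurable Omega" for n
    using E_meas[of 0] gX[OF s] by (intro borel_measurable_times) auto
  have \<phi>_meas: "\<phi> n \<in> borel_measurable borel" for n
    unfolding \<phi>_def by (rule integral_law_measurable[OF \<phi>_int_meas])
  have \<phi>_bound: "\<bar>\<phi> n y\<bar> \<le> exp (K * s) * M" for n y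
    unfolding \<phi>_def by (rule abs_integral_law_le[OF \<phi>_int_meas]) (rule EgM[OF g(2)])
  have \<psi>_int_meas: "(\<lambda>u. exp (path_int X f s u) * g (X s u)) \<in> borel_measurable Omega"
    using path_int_measurable[OF s] gX[OF s] by measurable
  have \<psi>_meas: "\<psi> \<in> borel_measurable borel"
    unfolding \<psi>_def by (rule integral_law_measurable[OF \<psi>_int_meas])
  have \<phi>_lim: "(\<lambda>n. \<phi> n y) \<longlonglongrightarrow> \<psi> y" for y
  proof -
    interpret prob_space "P y" by (rule prob_space_law)
    show ?thesis
      unfolding \<phi>_def \<psi>_def
    proof (rule integral_dominated_convergence[where w = "\<lambda>_. exp (K * s) * M"])
      show "AE u in P y. (\<lambda>n. E 0 n u * g (X s u)) \<longlonglongrightarrow> exp (path_int X f s u) * g (X s u)"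
        using E_lim[of _ 0] by (intro AE_I2 tendsto_intros) (auto simp: path_int_def)
      show "AE u in P y. norm (E 0 n u * g (X s u)) \<le> exp (K * s) * M" for n
        using EgM[OF g(2)] by simp
    qed (use \<phi>_int_meas \<psi>_int_meas in \<open>auto simp: measurable_cong_sets[OF sets_law refl]\<close>)
  qed
  interpret prob_space "P x" by (rule prob_space_law)
  have "(\<lambda>n. \<integral>v. Y v * (E t n v * g (X (t + s) v)) \<partial>P x)
    \<longlonglongrightarrow> (\<integral>v. Y v * (exp (integral {0..s} (\<lambda>u. f (X (t + u) v))) * g (X (t + s) v)) \<partial>P x)"
  proof (rule integral_dominated_convergence[where w = "\<lambda>_. C * (exp (K * s) * M)"])
    have lim: "(\<lambda>n. Y v * (E t n v * g (X (t + s) v))) \<longlonglongrightarrow>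
        Y v * (exp (integral {0..s} (\<lambda>u. f (X (t + u) v))) * g (X (t + s) v))" if "v \<in> space Omega" for v
      by (intro tendsto_intros E_lim that t)
    then show "AE v in P x. (\<lambda>n. Y v * (E t n v * g (X (t + s) v))) \<longlonglongrightarrow>
        Y v * (exp (integral {0..s} (\<lambda>u. f (X (t + u) v))) * g (X (t + s) v))"
      by (intro AE_I2) simp
    show "AE v in P x. norm (Y v * (E t n v * g (X (t + s) v))) \<le> C * (exp (K * s) * M)" for n
      using Y(2) EgM[OF g(2)] by (intro AE_I2) (simp add: abs_mult mult_mono')
    show m: "(\<lambda>v. Y v * (E t n v * g (X (t + s) v))) \<in> borel_measurable (P x)" for n
      using YO E_meas[OF t] gX[of "t + s"] t s
      by (auto simp: measurable_cong_sets[OF sets_law refl] intro!: borel_measurable_times)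
    \<comment> \<open>Measurability of the shifted integral is inherited from the approximations,
      which converge at every sample point.\<close>
    show "(\<lambda>v. Y v * (exp (integral {0..s} (\<lambda>u. f (X (t + u) v))) * g (X (t + s) v))) \<in> borel_measurable (P x)"
      by (rule borel_measurable_LIMSEQ_real[OF _ m]) (use lim in simp)
  qed simp
  moreover have "(\<lambda>n. \<integral>v. Y v * \<phi> n (X t v) \<partial>P x) \<longlonglongrightarrow> (\<integral>v. Y v * \<psi> (X t v) \<partial>P x)"
  proof (rule integral_dominated_convergence[where w = "\<lambda>_. C * (exp (K * s) * M)"])
    show "AE v in P x. (\<lambda>n. Y v * \<phi> n (X t v)) \<longlonglongrightarrow> Y v * \<psi> (X t v)"
      by (intro AE_I2 tendsto_intros \<phi>_lim)
    show "AE v in P x. norm (Y v * \<phi> n (X t v)) \<le> C * (exp (K * s) * M)" for n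
      using Y(2) \<phi>_bound by (intro AE_I2) (simp add: abs_mult mult_mono')
  qed (use YO measurable_compose[OF X_measurable[OF t] \<phi>_meas] measurable_compose[OF X_measurable[OF t] \<psi>_meas] in
      \<open>auto simp: measurable_cong_sets[OF sets_law refl] intro!: borel_measurable_times\<close>)
  moreover have "(\<integral>v. Y v * (E t n v * g (X (t + s) v)) \<partial>P x) = (\<integral>v. Y v * \<phi> n (X t v) \<partial>P x)" for n
  proof -
    have k: "(\<lambda>y. exp (h n * f y)) \<in> borel_measurable borel" using f_meas by measurable
    have kb: "\<bar>exp (h n * f y)\<bar> \<le> exp (h n * K)" for y
      using h[of n] order_trans[OF abs_ge_self f_bnd] by (auto intro: mult_left_mono)
    show ?thesis
      using markov_product[OF t h[of n] Y k kb g, where n = "Suc n" and x = x]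
      by (simp only: \<phi>_def E_def hs add_0)
  qed
  ultimately show ?thesis
    unfolding \<psi>_def by (simp add: LIMSEQ_unique)
qed

end

subsection \<open>The risk-sensitive growth rate\<close>

context
  fixes f :: "'a \<Rightarrow> real" and K :: real
  assumes f_cont: "continuous_on UNIV f" and f_bnd: "\<And>y. \<bar>f y\<bar> \<le> K"
    and f_nonpos: "\<And>y. f y \<le> 0"
begin

lemma path_int_nonpos: "v \<in> space Omega \<Longrightarrow> 0 \<le> t \<Longrightarrow> path_int X f t v \<le> 0"
  using integral_le[OF along_path_integral(1)[OF f_cont f_bnd, of v 0 t] integrable_0] f_nonpos
  by (simp add: path_int_def)

lemma exp_path_int_measurable:
  "0 \<le> t \<Longrightarrow> (\<lambda>v. exp (path_int X f t v)) \<in> borel_measurable Omega"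
  using path_int_measurable[OF f_cont f_bnd] by measurable

text \<open>\<open>risk_rate\<close> is defined through \<open>Lim\<close>, so existence of the
  limit must be proved. The Markov property makes the supremum of the expectations submultiplicative
  in time, and Fekete's lemma applies to its logarithm. Boundedness and positivity of that supremum
  come from the same estimates.\<close>

lemma risk_rate_tendsto:
  "((\<lambda>t. ln (SUP x. \<integral>v. exp (path_int X f t v) \<partial>P x) / t) \<longlongrightarrow> risk_rate P X f) at_top"
  and bdd_above_exp_path_int: "0 \<le> t \<Longrightarrow> bdd_above (range (\<lambda>x. \<integral>v. exp (path_int X f t v) \<partial>P x))"
  and SUP_exp_path_int_pos: "0 \<le> t \<Longrightarrow> 0 < (SUP x. \<integral>v. exp (path_int X f t v) \<partial>P x)"
proof -
  define e where "e = (\<lambda>t x. \<integral>v. exp (path_int X f t v) \<partial>P x)"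
  define S where "S = (\<lambda>t. SUP x. e t x)"
  have int: "integrable (P x) (\<lambda>v. exp (path_int X f t v))" if "0 \<le> t" for t x
    by (rule integrable_law_bounded[OF exp_path_int_measurable[OF that], where C = 1])
      (use path_int_nonpos that in auto)
  \<comment> \<open>These two bounds make the supremum finite and positive, and after taking
    logarithms they are the nonpositivity and linear lower bound required by Fekete's lemma.\<close>
  have e_le: "e t x \<le> 1" and e_ge: "exp (- K * t) \<le> e t x" if t: "0 \<le> t" for t x
  proof -
    interpret prob_space "P x" by (rule prob_space_law)
    have "e t x \<le> (\<integral>v. 1 \<partial>P x)"
      unfolding e_def using path_int_nonpos[OF _ t] by (intro integral_mono int[OF t]) auto
    then show "e t x \<le> 1" using prob_space by simp
    have "exp (- K * t) \<le> exp (path_int X f t v)" if "v \<in> space Omega" for v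
      using path_int_bound[OF f_cont f_bnd that t] by simp
    then have "(\<integral>v. exp (- K * t) \<partial>P x) \<le> e t x"
      unfolding e_def by (intro integral_mono int[OF t]) auto
    then show "exp (- K * t) \<le> e t x" using prob_space by simp
  qed
  have bdd: "bdd_above (range (e t))" if "0 \<le> t" for t
    using e_le[OF that] by (auto intro!: bdd_aboveI)
  then show "0 \<le> t \<Longrightarrow> bdd_above (range (\<lambda>x. \<integral>v. exp (path_int X f t v) \<partial>P x))"
    by (simp add: e_def)
  have e_S: "e t x \<le> S t" if "0 \<le> t" for t x
    unfolding S_def using bdd[OF that] by (rule cSUP_upper2) auto
  have S_le: "S t \<le> 1" and S_ge: "exp (- K * t) \<le> S t" if t: "0 \<le> t" for t
    using e_le[OF t] order_trans[OF e_ge[OF t] e_S[OF t]] unfolding S_def by (auto intro: cSUP_least)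
  have S_pos: "0 < S t" if "0 \<le> t" for t using less_le_trans[OF exp_gt_zero S_ge[OF that]] .
  then show "0 \<le> t \<Longrightarrow> 0 < (SUP x. \<integral>v. exp (path_int X f t v) \<partial>P x)"
    by (simp add: e_def S_def)
  have S_mult: "S (t + s) \<le> S t * S s" if t: "0 \<le> t" and s: "0 \<le> s" for t s
  proof -
    have "(SUP x. e (t + s) x) \<le> S t * S s"
    proof (rule cSUP_least)
      fix x
      interpret prob_space "P x" by (rule prob_space_law)
      \<comment> \<open>The trailing factor \<open>1\<close> stands for the terminal function in
        \<open>markov_path\<close>.\<close>
      have "e (t + s) x = (\<integral>v. exp (path_int X f t v) * (exp (integral {0..s} (\<lambda>u. f (X (t + u) v))) * 1) \<partial>P x)"
        unfolding e_def
        by (intro Bochner_Integration.integral_cong refl) (simp add: path_int_add[OF f_cont f_bnd _ t s] exp_add)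
      also have "\<dots> = (\<integral>v. exp (path_int X f t v) * (\<integral>u. exp (path_int X f s u) * 1 \<partial>P (X t v)) \<partial>P x)"
      proof (rule markov_path[OF f_cont f_bnd t s, where g = "\<lambda>_. 1" and C = 1 and M = 1])
        show "(\<lambda>v. exp (path_int X f t v)) \<in> borel_measurable (Fm t)"
          using path_int_adapted[OF f_cont f_bnd t] by measurable
      qed (use path_int_nonpos t in auto)
      also have "\<dots> = (\<integral>v. exp (path_int X f t v) * e s (X t v) \<partial>P x)" by (simp add: e_def)
      also have "\<dots> \<le> (\<integral>v. exp (path_int X f t v) * S s \<partial>P x)"
      proof (rule integral_mono)
        have em: "(\<lambda>v. e s (X t v)) \<in> borel_measurable Omega"
          unfolding e_def
          by (rule measurable_compose[OF X_measurable[OF t] integral_law_measurable[OF exp_path_int_measurable[OF s]]])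
        have e_abs: "\<bar>e s y\<bar> \<le> 1" for y
          using e_le[OF s, of y] e_ge[OF s, of y] exp_gt_zero[of "- K * s"] by linarith
        show "integrable (P x) (\<lambda>v. exp (path_int X f t v) * e s (X t v))"
        proof (rule integrable_law_bounded[of _ "1 * 1"])
          show "(\<lambda>v. exp (path_int X f t v) * e s (X t v)) \<in> borel_measurable Omega"
            using em exp_path_int_measurable[OF t] by (rule borel_measurable_times[rotated])
          show "\<bar>exp (path_int X f t v) * e s (X t v)\<bar> \<le> 1 * 1" if "v \<in> space Omega" for v
            unfolding abs_mult using path_int_nonpos[OF that t] e_abs by (intro mult_mono) auto
        qed
      qed (use int[OF t] e_S[OF s] in auto)
      also have "\<dots> = e t x * S s" by (simp add: e_def)
      also have "\<dots> \<le> S t * S s" using e_S[OF t] S_pos[OF s] by (intro mult_right_mono) auto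
      finally show "e (t + s) x \<le> S t * S s" .
    qed simp
    then show ?thesis unfolding S_def .
  qed
  have "((\<lambda>t. ln (S t) / t) \<longlongrightarrow> (INF t\<in>{0<..}. ln (S t) / t)) at_top"
  proof (rule subadditive_tendsto_Inf)
    show "ln (S (s + t)) \<le> ln (S s) + ln (S t)" if "0 \<le> s" "0 \<le> t" for s t
    proof -
      have "ln (S (s + t)) \<le> ln (S s * S t)"
        using S_mult[OF that] S_pos[of "s + t"] that by (intro ln_mono) auto
      then show ?thesis using S_pos that by (simp add: ln_mult_pos)
    qed
    show "ln (S t) \<le> 0" if "0 \<le> t" for t
      using S_le[OF that] S_pos[OF that] by simp
    show "- K * t \<le> ln (S t)" if "0 \<le> t" for t
      using S_ge[OF that] S_pos[OF that] by (simp add: ln_ge_iff)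
  qed
  moreover from tendsto_Lim[OF _ this] have "risk_rate P X f = (INF t\<in>{0<..}. ln (S t) / t)"
    by (simp add: risk_rate_def S_def e_def)
  ultimately show "((\<lambda>t. ln (SUP x. \<integral>v. exp (path_int X f t v) \<partial>P x) / t) \<longlongrightarrow> risk_rate P X f) at_top"
    by (simp add: S_def e_def)
qed

text \<open>For an intermediate rate \<open>\<mu>\<close> between \<open>risk_rate P X f\<close> and
  \<open>lam\<close>, the expectation is eventually at most \<open>exp (\<mu> * t)\<close>, so the
  discounted quantity decays at least at rate \<open>lam - \<mu>\<close>.\<close>

lemma discounted_expectation_tendsto_0:
  assumes lam: "risk_rate P X f < lam"
  shows "((\<lambda>t. exp (- lam * t) * (\<integral>v. exp (path_int X f t v) \<partial>P x)) \<longlongrightarrow> 0) at_top"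
proof -
  obtain \<mu> where \<mu>: "risk_rate P X f < \<mu>" "\<mu> < lam" using dense[OF lam] by blast
  have "\<forall>\<^sub>F t in at_top. ln (SUP x. \<integral>v. exp (path_int X f t v) \<partial>P x) / t < \<mu>"
    using order_tendstoD(2)[OF risk_rate_tendsto \<mu>(1)] .
  then have ev: "\<forall>\<^sub>F t in at_top. exp (- lam * t) * (\<integral>v. exp (path_int X f t v) \<partial>P x) \<le> exp (- ((lam - \<mu>) * t))"
    using eventually_gt_at_top[of 0]
  proof eventually_elim
    case (elim t)
    then have t: "0 \<le> t" by simp
    have "(\<integral>v. exp (path_int X f t v) \<partial>P x) \<le> (SUP x. \<integral>v. exp (path_int X f t v) \<partial>P x)"
      using bdd_above_exp_path_int[OF t] by (rule cSUP_upper2) auto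
    also have "\<dots> \<le> exp (\<mu> * t)"
      using elim SUP_exp_path_int_pos[OF t]
      by (metis exp_le_cancel_iff exp_ln less_imp_le pos_divide_less_eq)
    finally have "exp (- lam * t) * (\<integral>v. exp (path_int X f t v) \<partial>P x) \<le> exp (- lam * t) * exp (\<mu> * t)"
      by (intro mult_left_mono) auto
    also have "\<dots> = exp (- ((lam - \<mu>) * t))" by (simp add: exp_add[symmetric] algebra_simps)
    finally show ?case .
  qed
  have "filterlim (\<lambda>t. (lam - \<mu>) * t) at_top at_top"
    using \<mu> by (intro filterlim_tendsto_pos_mult_at_top[OF tendsto_const] filterlim_ident) auto
  then have lim: "((\<lambda>t. exp (- ((lam - \<mu>) * t))) \<longlongrightarrow> 0) at_top"
    by (intro filterlim_compose[OF exp_at_bot] filterlim_compose[OF filterlim_uminus_at_bot_at_top])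
  show ?thesis
    by (rule tendsto_sandwich[OF _ ev tendsto_const lim]) (auto intro!: always_eventually integral_nonneg_AE)
qed

end

subsection \<open>Optional stopping on the grid\<close>

text \<open>Encoded by the events "not yet stopped at \<open>k\<close>", because the stopped process
  moves from \<open>k\<close> to \<open>k + 1\<close> exactly there; minima and exit times are also
  handled most directly in this form.\<close>

definition grid_stopping :: "real \<Rightarrow> ('w \<Rightarrow> enat) \<Rightarrow> bool" where
  "grid_stopping \<delta> \<rho> \<longleftrightarrow> (\<forall>k::nat. {v \<in> space Omega. enat k < \<rho> v} \<in> F (real k * \<delta>))"

lemma grid_stopping_iff_eq:
  assumes \<delta>: "0 \<le> \<delta>"
  shows "grid_stopping \<delta> \<rho> \<longleftrightarrow> (\<forall>k::nat. {v \<in> space Omega. \<rho> v = enat k} \<in> F (real k * \<delta>))"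
proof
  assume *: "grid_stopping \<delta> \<rho>"
  show "\<forall>k::nat. {v \<in> space Omega. \<rho> v = enat k} \<in> F (real k * \<delta>)"
  proof
    fix k :: nat
    interpret sigma_algebra "space Omega" "F (real k * \<delta>)" using \<delta> by (intro sigma_algebra_F) simp
    have gt: "{v \<in> space Omega. enat k < \<rho> v} \<in> F (real k * \<delta>)"
      using * unfolding grid_stopping_def by blast
    show "{v \<in> space Omega. \<rho> v = enat k} \<in> F (real k * \<delta>)"
    proof (cases k)
      case 0
      then have "{v \<in> space Omega. \<rho> v = enat k} = space Omega - {v \<in> space Omega. enat k < \<rho> v}"
        by (auto simp: zero_enat_def[symmetric])
      then show ?thesis using gt by auto
    next
      case (Suc j)
      have "F (real j * \<delta>) \<subseteq> F (real k * \<delta>)" using \<delta> Suc by (intro F_mono mult_right_mono) auto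
      then have "{v \<in> space Omega. enat j < \<rho> v} \<in> F (real k * \<delta>)"
        using * unfolding grid_stopping_def by blast
      moreover have "{v \<in> space Omega. \<rho> v = enat k} =
          {v \<in> space Omega. enat j < \<rho> v} - {v \<in> space Omega. enat k < \<rho> v}"
        using Suc by (auto simp: not_less) (metis Suc_ile_eq antisym)
      ultimately show ?thesis using gt by auto
    qed
  qed
next
  assume *: "\<forall>k::nat. {v \<in> space Omega. \<rho> v = enat k} \<in> F (real k * \<delta>)"
  show "grid_stopping \<delta> \<rho>"
    unfolding grid_stopping_def
  proof
    fix k :: nat
    interpret sigma_algebra "space Omega" "F (real k * \<delta>)" using \<delta> by (intro sigma_algebra_F) simp
    have "{v \<in> space Omega. \<rho> v = enat j} \<in> F (real k * \<delta>)" if "j \<le> k" for j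
    proof -
      have "F (real j * \<delta>) \<subseteq> F (real k * \<delta>)" using \<delta> that by (intro F_mono mult_right_mono) auto
      then show ?thesis using * by blast
    qed
    then have "space Omega - (\<Union>j\<in>{..k}. {v \<in> space Omega. \<rho> v = enat j}) \<in> F (real k * \<delta>)"
      by (intro compl_sets finite_UN) auto
    moreover have "space Omega - (\<Union>j\<in>{..k}. {v \<in> space Omega. \<rho> v = enat j}) = {v \<in> space Omega. enat k < \<rho> v}"
    proof -
      have "enat k < r \<longleftrightarrow> (\<forall>j\<le>k. r \<noteq> enat j)" for r
        by (cases r) (auto, metis not_le)
      then show ?thesis by auto
    qed
    ultimately show "{v \<in> space Omega. enat k < \<rho> v} \<in> F (real k * \<delta>)" by simp
  qed
qed

lemma grid_stopping_min:
  assumes "0 \<le> \<delta>" "grid_stopping \<delta> \<rho>" "grid_stopping \<delta> \<rho>'"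
  shows "grid_stopping \<delta> (\<lambda>v. min (\<rho> v) (\<rho>' v))"
  unfolding grid_stopping_def
proof
  fix k :: nat
  interpret sigma_algebra "space Omega" "F (real k * \<delta>)" using assms by (intro sigma_algebra_F) simp
  have "{v \<in> space Omega. enat k < min (\<rho> v) (\<rho>' v)} =
      {v \<in> space Omega. enat k < \<rho> v} \<inter> {v \<in> space Omega. enat k < \<rho>' v}" by auto
  then show "{v \<in> space Omega. enat k < min (\<rho> v) (\<rho>' v)} \<in> F (real k * \<delta>)"
    using assms unfolding grid_stopping_def by auto
qed

lemma grid_stopping_const:
  assumes "0 \<le> \<delta>"
  shows "grid_stopping \<delta> (\<lambda>_. r)"
  unfolding grid_stopping_def
proof
  fix k :: nat
  interpret sigma_algebra "space Omega" "F (real k * \<delta>)" using assms by (intro sigma_algebra_F) simp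
  show "{v \<in> space Omega. enat k < r} \<in> F (real k * \<delta>)"
    by (cases "enat k < r") auto
qed

lemma grid_stopping_exit_index:
  assumes \<delta>: "0 \<le> \<delta>" and B: "B \<in> sets borel"
  shows "grid_stopping \<delta> (exit_index \<delta> X B)"
  unfolding grid_stopping_def
proof
  fix k :: nat
  have k: "0 \<le> real k * \<delta>" using \<delta> by simp
  have "{v \<in> space (Fm (real k * \<delta>)). \<forall>j\<in>{..k}. X (real j * \<delta>) v \<in> B} \<in> sets (Fm (real k * \<delta>))"
  proof (rule sets.sets_Collect_finite_All')
    fix j assume "j \<in> {..k}"
    then have "X (real j * \<delta>) \<in> Fm (real k * \<delta>) \<rightarrow>\<^sub>M borel"
      using \<delta> by (intro X_adapted) (auto simp: mult_right_mono)
    from measurable_sets[OF this B]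
    show "{v \<in> space (Fm (real k * \<delta>)). X (real j * \<delta>) v \<in> B} \<in> sets (Fm (real k * \<delta>))"
      by (simp add: vimage_def Int_def conj_commute)
  qed auto
  then show "{v \<in> space Omega. enat k < exit_index \<delta> X B v} \<in> F (real k * \<delta>)"
    using k by (simp add: less_exit_index_iff sets_Fm Ball_def)
qed

lemma grid_stopping_measurable:
  assumes \<delta>: "0 \<le> \<delta>" and \<rho>: "grid_stopping \<delta> \<rho>"
  shows "\<rho> \<in> Omega \<rightarrow>\<^sub>M count_space UNIV"
proof -
  have fin: "{v \<in> space Omega. \<rho> v = enat k} \<in> sets Omega" for k
    using \<rho> F_subset[of "real k * \<delta>"] \<delta> unfolding grid_stopping_iff_eq[OF \<delta>] by auto
  have "\<rho> -` {r} \<inter> space Omega \<in> sets Omega" for r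
  proof (cases r)
    case (enat k)
    then show ?thesis using fin[of k] by (simp add: vimage_def Int_def conj_commute)
  next
    case infinity
    have "\<rho> -` {\<infinity>} \<inter> space Omega = space Omega - (\<Union>k. {v \<in> space Omega. \<rho> v = enat k})"
      by auto
    then show ?thesis using fin infinity by auto
  qed
  then show ?thesis by (auto simp: measurable_count_space_eq2_countable)
qed

text \<open>A random index with countably many values selects among measurable functions. On the
  event of an infinite index, \<open>the_enat\<close> gives some fixed index, which does not affect
  measurability.\<close>

lemma stopped_measurable:
  fixes H :: "nat \<Rightarrow> 'w \<Rightarrow> real"
  assumes "0 \<le> \<delta>" "grid_stopping \<delta> \<rho>" and H: "\<And>k. H k \<in> borel_measurable Omega"
  shows "(\<lambda>v. H (the_enat (\<rho> v)) v) \<in> borel_measurable Omega"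
  by (rule measurable_compose_countable[OF H])
    (rule measurable_compose[OF grid_stopping_measurable[OF assms(1,2)]], simp)

text \<open>One definition serves two processes: with running cost \<open>f - lam\<close>, the
  terminal function \<open>w\<close> gives the candidate value process and \<open>Mop c U w\<close>
  gives the payoff process.\<close>

definition discounted_value :: "('a \<Rightarrow> real) \<Rightarrow> real \<Rightarrow> ('a \<Rightarrow> real) \<Rightarrow> nat \<Rightarrow> 'w \<Rightarrow> real" where
  "discounted_value f \<delta> w k v = exp (path_int X f (real k * \<delta>) v + w (X (real k * \<delta>) v))"

section \<open>The discounted value process stopped on the grid\<close>

context
  fixes f :: "'a \<Rightarrow> real" and K :: real and \<delta> :: real and w :: "'a \<Rightarrow> real" and W :: real
  assumes f_cont: "continuous_on UNIV f" and f_bnd: "\<And>y. \<bar>f y\<bar> \<le> K"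
    and \<delta>: "0 < \<delta>"
    and w_meas: "w \<in> borel_measurable borel" and w_bnd: "\<And>y. \<bar>w y\<bar> \<le> W"
begin

private abbreviation "Z \<equiv> discounted_value f \<delta> w"

lemma grid_nonneg: "0 \<le> real k * \<delta>"
  using \<delta> by simp

lemma K_nonneg: "0 \<le> K"
  using order_trans[OF abs_ge_zero f_bnd] .

lemma discounted_value_measurable: "Z k \<in> borel_measurable Omega"
  unfolding discounted_value_def
  using path_int_measurable[OF f_cont f_bnd grid_nonneg]
    measurable_compose[OF X_measurable[OF grid_nonneg] w_meas] by measurable

lemma discounted_value_bound:
  assumes v: "v \<in> space Omega" and "k \<le> n"
  shows "Z k v \<le> exp (K * (real n * \<delta>) + W)" "exp (- (K * (real n * \<delta>) + W)) \<le> Z k v"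
proof -
  have "\<bar>path_int X f (real k * \<delta>) v\<bar> \<le> K * (real k * \<delta>)"
    by (rule path_int_bound[OF f_cont f_bnd v grid_nonneg])
  also have "\<dots> \<le> K * (real n * \<delta>)"
    using K_nonneg \<delta> assms(2) by (intro mult_left_mono mult_right_mono) auto
  finally have "\<bar>path_int X f (real k * \<delta>) v + w (X (real k * \<delta>) v)\<bar> \<le> K * (real n * \<delta>) + W"
    using w_bnd[of "X (real k * \<delta>) v"] by linarith
  then show "Z k v \<le> exp (K * (real n * \<delta>) + W)" "exp (- (K * (real n * \<delta>) + W)) \<le> Z k v"
    unfolding discounted_value_def by auto
qed

lemma discounted_value_stopped_integrable:
  assumes "grid_stopping \<delta> \<rho>"
  shows "integrable (P x) (\<lambda>v. Z (the_enat (min (\<rho> v) (enat n))) v)"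
proof (rule integrable_law_bounded)
  have "grid_stopping \<delta> (\<lambda>v. min (\<rho> v) (enat n))"
    using \<delta> assms by (intro grid_stopping_min grid_stopping_const) auto
  from stopped_measurable[OF _ this discounted_value_measurable] \<delta>
  show "(\<lambda>v. Z (the_enat (min (\<rho> v) (enat n))) v) \<in> borel_measurable Omega" by simp
  show "\<bar>Z (the_enat (min (\<rho> v) (enat n))) v\<bar> \<le> exp (K * (real n * \<delta>) + W)" if "v \<in> space Omega" for v
  proof -
    have "the_enat (min (\<rho> v) (enat n)) \<le> n" by (cases "\<rho> v") auto
    from discounted_value_bound(1)[OF that this] show ?thesis by (simp add: discounted_value_def)
  qed
qed

text \<open>The stopped process changes between \<open>n\<close> and \<open>n + 1\<close> only on
  \<open>n < \<rho>\<close>, an event known at time \<open>n * \<delta>\<close>. The Markov property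
  at that time replaces the increment by a one-step drift depending on the current position.\<close>

lemma discounted_value_stopped_step:
  assumes \<rho>: "grid_stopping \<delta> \<rho>"
  shows "(\<integral>v. Z (the_enat (min (\<rho> v) (enat (Suc n)))) v \<partial>P x) =
    (\<integral>v. Z (the_enat (min (\<rho> v) (enat n))) v \<partial>P x) +
    (\<integral>v. indicator {v. enat n < \<rho> v} v * exp (path_int X f (real n * \<delta>) v) *
       ((\<integral>u. exp (path_int X f \<delta> u + w (X \<delta> u)) \<partial>P (X (real n * \<delta>) v)) - exp (w (X (real n * \<delta>) v))) \<partial>P x)"
proof -
  define t where "t = real n * \<delta>"
  have t: "0 \<le> t" unfolding t_def by (rule grid_nonneg)
  have \<delta>0: "0 \<le> \<delta>" using \<delta> by simp
  define I where "I = (indicator {v \<in> space Omega. enat n < \<rho> v} :: 'w \<Rightarrow> real)"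
  define \<psi> where "\<psi> = (\<lambda>y. \<integral>u. exp (path_int X f \<delta> u) * exp (w (X \<delta> u)) \<partial>P y)"
  have I_Fm: "I \<in> borel_measurable (Fm t)"
    using \<rho> t unfolding I_def grid_stopping_def
    by (intro borel_measurable_indicator) (simp add: sets_Fm t_def)
  have p_Fm: "(\<lambda>v. exp (path_int X f t v)) \<in> borel_measurable (Fm t)"
    using path_int_adapted[OF f_cont f_bnd t] by measurable
  \<comment> \<open>Everything known at time \<open>t\<close>: the event of not having stopped and
    the weight accumulated so far.\<close>
  define Y where "Y = (\<lambda>v. I v * exp (path_int X f t v))"
  have Y_Fm: "Y \<in> borel_measurable (Fm t)"
    unfolding Y_def using I_Fm p_Fm by (rule borel_measurable_times)
  have Y_O: "Y \<in> borel_measurable Omega" by (rule measurable_Fm_Omega[OF Y_Fm t])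
  have Y_bnd: "\<bar>Y v\<bar> \<le> 1 * exp (K * t)" if "v \<in> space Omega" for v
    unfolding Y_def abs_mult using path_int_bound[OF f_cont f_bnd that t]
    by (intro mult_mono) (auto simp: I_def indicator_def)
  have w_exp: "(\<lambda>y. exp (w y)) \<in> borel_measurable borel" "\<bar>exp (w y)\<bar> \<le> exp W" for y
    using w_meas w_bnd[of y] by auto
  have \<psi>_int: "(\<lambda>u. exp (path_int X f \<delta> u) * exp (w (X \<delta> u))) \<in> borel_measurable Omega"
    using path_int_measurable[OF f_cont f_bnd \<delta>0] measurable_compose[OF X_measurable[OF \<delta>0] w_exp(1)]
    by measurable
  have \<psi>_meas: "\<psi> \<in> borel_measurable borel"
    unfolding \<psi>_def by (rule integral_law_measurable[OF \<psi>_int])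
  have \<psi>_bnd: "\<bar>\<psi> y\<bar> \<le> exp (K * \<delta>) * exp W" for y
    unfolding \<psi>_def
  proof (rule abs_integral_law_le[OF \<psi>_int])
    fix u assume "u \<in> space Omega"
    then show "\<bar>exp (path_int X f \<delta> u) * exp (w (X \<delta> u))\<bar> \<le> exp (K * \<delta>) * exp W"
      unfolding abs_mult using path_int_bound[OF f_cont f_bnd _ \<delta>0, of u] w_exp(2)
      by (intro mult_mono) auto
  qed
  have int1: "integrable (P x) (\<lambda>v. Y v * \<psi> (X t v))"
  proof (rule integrable_law_bounded)
    show "(\<lambda>v. Y v * \<psi> (X t v)) \<in> borel_measurable Omega"
      using Y_O measurable_compose[OF X_measurable[OF t] \<psi>_meas] by (rule borel_measurable_times)
    show "\<bar>Y v * \<psi> (X t v)\<bar> \<le> (1 * exp (K * t)) * (exp (K * \<delta>) * exp W)" if "v \<in> space Omega" for v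
      unfolding abs_mult using Y_bnd[OF that] \<psi>_bnd by (intro mult_mono) auto
  qed
  have int2: "integrable (P x) (\<lambda>v. Y v * exp (w (X t v)))"
  proof (rule integrable_law_bounded)
    show "(\<lambda>v. Y v * exp (w (X t v))) \<in> borel_measurable Omega"
      using Y_O measurable_compose[OF X_measurable[OF t] w_exp(1)] by (rule borel_measurable_times)
    show "\<bar>Y v * exp (w (X t v))\<bar> \<le> (1 * exp (K * t)) * exp W" if "v \<in> space Omega" for v
      unfolding abs_mult[of "Y v"] using Y_bnd[OF that] w_exp(2) by (intro mult_mono) auto
  qed
  note int_stopped = discounted_value_stopped_integrable[OF \<rho>, of x]
  have "(\<integral>v. Z (the_enat (min (\<rho> v) (enat (Suc n)))) v \<partial>P x) - (\<integral>v. Z (the_enat (min (\<rho> v) (enat n))) v \<partial>P x)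
    = (\<integral>v. Z (the_enat (min (\<rho> v) (enat (Suc n)))) v - Z (the_enat (min (\<rho> v) (enat n))) v \<partial>P x)"
    by (rule Bochner_Integration.integral_diff[OF int_stopped int_stopped, symmetric])
  also have "\<dots> = (\<integral>v. Y v * (exp (integral {0..\<delta>} (\<lambda>u. f (X (t + u) v))) * exp (w (X (t + \<delta>) v)))
      - Y v * exp (w (X t v)) \<partial>P x)"
  proof (rule Bochner_Integration.integral_cong[OF refl])
    fix v assume "v \<in> space (P x)"
    then have v: "v \<in> space Omega" by simp
    show "Z (the_enat (min (\<rho> v) (enat (Suc n)))) v - Z (the_enat (min (\<rho> v) (enat n))) v =
      Y v * (exp (integral {0..\<delta>} (\<lambda>u. f (X (t + u) v))) * exp (w (X (t + \<delta>) v))) - Y v * exp (w (X t v))"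
    proof (cases "enat n < \<rho> v")
      case True
      then have "min (\<rho> v) (enat (Suc n)) = enat (Suc n)" "min (\<rho> v) (enat n) = enat n"
        by (cases "\<rho> v"; auto simp: min_def)+
      moreover have "real (Suc n) * \<delta> = t + \<delta>" by (simp add: t_def algebra_simps)
      ultimately show ?thesis
        using True v path_int_add[OF f_cont f_bnd v t \<delta>0]
        by (simp add: discounted_value_def Y_def I_def t_def[symmetric] exp_add mult.assoc del: of_nat_Suc)
    next
      case False
      then obtain k where "\<rho> v = enat k" "k \<le> n" by (cases "\<rho> v") auto
      then show ?thesis by (simp add: Y_def I_def)
    qed
  qed
  also have "\<dots> = (\<integral>v. Y v * (exp (integral {0..\<delta>} (\<lambda>u. f (X (t + u) v))) * exp (w (X (t + \<delta>) v))) \<partial>P x)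
      - (\<integral>v. Y v * exp (w (X t v)) \<partial>P x)"
  proof (rule Bochner_Integration.integral_diff[OF _ int2])
    show "integrable (P x) (\<lambda>v. Y v * (exp (integral {0..\<delta>} (\<lambda>u. f (X (t + u) v))) * exp (w (X (t + \<delta>) v))))"
    \<comment> \<open>Additivity of the path integral identifies the integrand with the value
      process at \<open>n + 1\<close> restricted to \<open>n < \<rho>\<close>, which is
      bounded.\<close>
    proof (rule Bochner_Integration.integrable_cong[OF refl, where g = "\<lambda>v. I v * Z (Suc n) v", THEN iffD2])
      fix v assume "v \<in> space (P x)"
      then have v: "v \<in> space Omega" by simp
      have "real (Suc n) * \<delta> = t + \<delta>" by (simp add: t_def algebra_simps)
      then show "Y v * (exp (integral {0..\<delta>} (\<lambda>u. f (X (t + u) v))) * exp (w (X (t + \<delta>) v))) = I v * Z (Suc n) v"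
        using path_int_add[OF f_cont f_bnd v t \<delta>0]
        by (simp add: discounted_value_def Y_def exp_add mult.assoc del: of_nat_Suc)
    next
      show "integrable (P x) (\<lambda>v. I v * Z (Suc n) v)"
      proof (rule integrable_law_bounded)
        show "(\<lambda>v. I v * Z (Suc n) v) \<in> borel_measurable Omega"
          using measurable_Fm_Omega[OF I_Fm t] discounted_value_measurable by (rule borel_measurable_times)
        show "\<bar>I v * Z (Suc n) v\<bar> \<le> exp (K * (real (Suc n) * \<delta>) + W)" if "v \<in> space Omega" for v
          using discounted_value_bound(1)[OF that, of "Suc n" "Suc n"] by (auto simp: I_def indicator_def discounted_value_def)
      qed
    qed
  qed
  also have "\<dots> = (\<integral>v. Y v * \<psi> (X t v) \<partial>P x) - (\<integral>v. Y v * exp (w (X t v)) \<partial>P x)"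
    using markov_path[OF f_cont f_bnd t \<delta>0 Y_Fm Y_bnd w_exp] by (simp add: \<psi>_def)
  also have "\<dots> = (\<integral>v. Y v * \<psi> (X t v) - Y v * exp (w (X t v)) \<partial>P x)"
    by (rule Bochner_Integration.integral_diff[OF int1 int2, symmetric])
  also have "\<dots> = (\<integral>v. indicator {v. enat n < \<rho> v} v * exp (path_int X f (real n * \<delta>) v) *
       ((\<integral>u. exp (path_int X f \<delta> u + w (X \<delta> u)) \<partial>P (X (real n * \<delta>) v)) - exp (w (X (real n * \<delta>) v))) \<partial>P x)"
    by (rule Bochner_Integration.integral_cong[OF refl])
      (simp add: Y_def I_def t_def[symmetric] \<psi>_def exp_add indicator_def right_diff_distrib)
  finally show ?thesis by simp
qed

lemma discounted_value_stopped_0: "(\<integral>v. Z (the_enat (min (\<rho> v) (enat 0))) v \<partial>P x) = exp (w x)"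
proof -
  interpret prob_space "P x" by (rule prob_space_law)
  have "(\<integral>v. Z (the_enat (min (\<rho> v) (enat 0))) v \<partial>P x) = (\<integral>v. Z 0 v \<partial>P x)"
  proof -
    have "min r (enat 0) = enat 0" for r by (simp add: zero_enat_def[symmetric])
    then show ?thesis by simp
  qed
  also have "\<dots> = (\<integral>v. exp (w x) \<partial>P x)"
  proof (rule integral_cong_AE)
    show "AE v in P x. Z 0 v = exp (w x)"
      using AE_start[of x] by eventually_elim (simp add: discounted_value_def path_int_def)
  qed (use discounted_value_measurable in \<open>auto simp: measurable_cong_sets[OF sets_law refl]\<close>)
  finally show ?thesis using prob_space by simp
qed

text \<open>The drift is nonpositive before \<open>\<rho>\<close>, so the stopped expectations never
  rise above their initial value; the drift condition is demanded only on paths that have not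
  stopped.\<close>

lemma discounted_value_supermartingale:
  assumes \<rho>: "grid_stopping \<delta> \<rho>"
    and sup: "\<And>k v. v \<in> space Omega \<Longrightarrow> enat k < \<rho> v \<Longrightarrow>
      (\<integral>u. exp (path_int X f \<delta> u + w (X \<delta> u)) \<partial>P (X (real k * \<delta>) v)) \<le> exp (w (X (real k * \<delta>) v))"
  shows "(\<integral>v. Z (the_enat (min (\<rho> v) (enat n))) v \<partial>P x) \<le> exp (w x)"
proof (induction n)
  case 0
  then show ?case by (simp add: discounted_value_stopped_0)
next
  case (Suc n)
  have "0 \<le> (\<integral>v. - (indicator {v. enat n < \<rho> v} v * exp (path_int X f (real n * \<delta>) v) *
       ((\<integral>u. exp (path_int X f \<delta> u + w (X \<delta> u)) \<partial>P (X (real n * \<delta>) v)) - exp (w (X (real n * \<delta>) v)))) \<partial>P x)"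
    by (rule integral_nonneg_AE) (use sup in \<open>auto intro!: AE_I2 mult_nonneg_nonpos simp: indicator_def\<close>)
  with Suc show ?case unfolding discounted_value_stopped_step[OF \<rho>, where n = n] by simp
qed

lemma discounted_value_martingale:
  assumes \<rho>: "grid_stopping \<delta> \<rho>"
    and eq: "\<And>k v. v \<in> space Omega \<Longrightarrow> enat k < \<rho> v \<Longrightarrow>
      (\<integral>u. exp (path_int X f \<delta> u + w (X \<delta> u)) \<partial>P (X (real k * \<delta>) v)) = exp (w (X (real k * \<delta>) v))"
  shows "(\<integral>v. Z (the_enat (min (\<rho> v) (enat n))) v \<partial>P x) = exp (w x)"
proof (induction n)
  case 0
  then show ?case by (rule discounted_value_stopped_0)
next
  case (Suc n)
  have "(\<integral>v. indicator {v. enat n < \<rho> v} v * exp (path_int X f (real n * \<delta>) v) *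
       ((\<integral>u. exp (path_int X f \<delta> u + w (X \<delta> u)) \<partial>P (X (real n * \<delta>) v)) - exp (w (X (real n * \<delta>) v))) \<partial>P x) = (\<integral>v. 0 \<partial>P x)"
    by (rule Bochner_Integration.integral_cong[OF refl]) (use eq in \<open>auto simp: indicator_def\<close>)
  with Suc show ?case unfolding discounted_value_stopped_step[OF \<rho>, where n = n] by simp
qed

end

end

theorem theorem3p4:
  fixes Omega :: "'w measure" and P :: "'a::{metric_space,second_countable_topology} \<Rightarrow> 'w measure"
    and F :: "real \<Rightarrow> 'w set set" and X :: "real \<Rightarrow> 'w \<Rightarrow> 'a"
    and f :: "'a \<Rightarrow> real" and c :: "'a \<Rightarrow> 'a \<Rightarrow> real"
    and U B :: "'a set" and \<delta> lam :: real and w :: "'a \<Rightarrow> real"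
  assumes loc_compact: "locally compact (UNIV :: 'a set)"
    and proc: "standard_feller_markov Omega P F X"
    and A2: "assumption_A2 Omega P X"
    and A3: "assumption_A3 Omega P X"
    and A4: "assumption_A4 Omega P X \<delta> B"
    and U: "compact U" "U \<noteq> {}"
    and B: "compact B" "U \<subseteq> B"
    and f: "continuous_on UNIV f" "bounded (range f)" "\<forall>x. f x \<le> 0"
    and c: "continuous_on (UNIV \<times> U) (\<lambda>(x, \<xi>). c x \<xi>)" "bounded ((\<lambda>(x, \<xi>). c x \<xi>) ` (UNIV \<times> U))"
           "\<forall>x. \<forall>\<xi>\<in>U. c x \<xi> \<le> 0"
    and delta: "\<delta> > 0"
    and OS: "OS_solution Omega P X f c U B \<delta> w lam"
    and lam_gt: "lam > risk_rate P X f"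
    and x: "x \<in> B"
  shows "ereal (w x) =
    (SUP \<sigma>\<in>grid_stopping_times_bdd Omega P F \<delta> x. ereal (stopped_value Omega P X f c U B \<delta> w lam \<sigma> x))"
proof -
  interpret feller_markov_process Omega P F X by unfold_locales (rule proc)
  define m where "m = Mop c U w"
  define g where "g = (\<lambda>y. f y - lam)"
  have \<delta>0: "0 \<le> \<delta>" using delta by simp
  obtain Kf where Kf: "\<And>y. \<bar>f y\<bar> \<le> Kf" using f(2) by (auto simp: bounded_iff)
  have g_cont: "continuous_on UNIV g" unfolding g_def using f(1) by (intro continuous_intros)
  define K where "K = Kf + \<bar>lam\<bar>"
  have K: "\<bar>g y\<bar> \<le> K" for y using Kf[of y] unfolding g_def K_def by linarith
  obtain Kc where Kc: "\<And>y \<xi>. \<xi> \<in> U \<Longrightarrow> \<bar>c y \<xi>\<bar> \<le> Kc"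
    using c(2) by (fastforce simp: bounded_iff)
  have wB: "continuous_on B w" "bounded (w ` B)" and w_off: "\<And>y. y \<notin> B \<Longrightarrow> w y = m y"
    using OS unfolding OS_solution_def m_def by auto
  obtain W0 where W0: "\<And>y. y \<in> B \<Longrightarrow> \<bar>w y\<bar> \<le> W0" using wB(2) by (auto simp: bounded_iff)
  have Kc_nonneg: "0 \<le> Kc" using U(2) Kc by (meson abs_ge_zero all_not_in_conv order_trans)
  \<comment> \<open>Bounds \<open>c + w\<close> on \<open>U\<close>, hence \<open>Mw\<close>
    everywhere. As \<open>Kc\<close> is nonnegative it also dominates \<open>W0\<close>, so it
    bounds \<open>w\<close> both on and off \<open>B\<close>.\<close>
  define W where "W = Kc + W0"
  have cw: "\<bar>c y \<xi> + w \<xi>\<bar> \<le> W" if "\<xi> \<in> U" for y \<xi>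
    using Kc[OF that, of y] W0[of \<xi>] that B(2) unfolding W_def by force
  have m_bnd: "\<bar>m y\<bar> \<le> W" for y
    unfolding m_def by (rule abs_Mop_le[OF U(2) cw])
  have w_bnd: "\<bar>w y\<bar> \<le> W" for y
    using m_bnd[of y] w_off[of y] W0[of y] Kc_nonneg unfolding W_def by (cases "y \<in> B") auto
  have m_meas: "m \<in> borel_measurable borel"
    unfolding m_def by (rule Mop_measurable[OF U(2) c(1) abs_le_D1[OF cw]])
  have B_borel: "B \<in> sets borel" using B(1) by (simp add: borel_compact)
  have w_meas: "w \<in> borel_measurable borel"
  proof -
    \<comment> \<open>Glues the continuous function on the closed set \<open>B\<close> to the
      measurable function \<open>m\<close> outside it.\<close>
    have "(\<lambda>y. indicator B y *\<^sub>R w y) \<in> borel_measurable borel"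
      by (rule borel_measurable_continuous_on_indicator[OF B_borel wB(1)])
    then have "(\<lambda>y. if y \<in> B then indicator B y *\<^sub>R w y else m y) \<in> borel_measurable borel"
      using m_meas B_borel by (intro measurable_If_set) auto
    also have "(\<lambda>y. if y \<in> B then indicator B y *\<^sub>R w y else m y) = w"
      using w_off by (auto simp: fun_eq_iff)
    finally show ?thesis .
  qed
  define \<psi> where "\<psi> = (\<lambda>y. \<integral>u. exp (path_int X g \<delta> u + w (X \<delta> u)) \<partial>P y)"
  \<comment> \<open>Positivity allows the logarithm in the one-step equation to be inverted.\<close>
  have \<psi>_pos: "0 < \<psi> y" for y
  proof -
    interpret prob_space "P y" by (rule prob_space_law)
    have bd: "\<bar>path_int X g \<delta> u + w (X \<delta> u)\<bar> \<le> K * \<delta> + W" if "u \<in> space Omega" for u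
      using path_int_bound[OF g_cont K that \<delta>0] w_bnd[of "X \<delta> u"] by linarith
    have meas: "(\<lambda>u. exp (path_int X g \<delta> u + w (X \<delta> u))) \<in> borel_measurable Omega"
      using path_int_measurable[OF g_cont K \<delta>0] measurable_compose[OF X_measurable[OF \<delta>0] w_meas]
      by measurable
    have "(\<integral>u. exp (- (K * \<delta> + W)) \<partial>P y) \<le> \<psi> y"
      unfolding \<psi>_def
    proof (rule integral_mono)
      show "integrable (P y) (\<lambda>u. exp (path_int X g \<delta> u + w (X \<delta> u)))"
        by (rule integrable_law_bounded[OF meas, of "exp (K * \<delta> + W)"]) (use bd in fastforce)
      show "exp (- (K * \<delta> + W)) \<le> exp (path_int X g \<delta> u + w (X \<delta> u))" if "u \<in> space (P y)" for u
        using bd[of u] that by (simp add: abs_le_iff)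
    qed simp
    then have "exp (- (K * \<delta> + W)) \<le> \<psi> y" using prob_space by simp
    then show ?thesis by (rule less_le_trans[OF exp_gt_zero])
  qed
  have OS_B: "w y = max (ln (\<psi> y)) (m y)" if "y \<in> B" for y
  proof -
    \<comment> \<open>The case distinction in the one-step equation collapses because
      \<open>w\<close> equals \<open>Mw\<close> off \<open>B\<close>.\<close>
    have "(if X \<delta> v \<in> B then w (X \<delta> v) else Mop c U w (X \<delta> v)) = w (X \<delta> v)" for v
      using w_off by (simp add: m_def)
    then show ?thesis
      using OS that unfolding OS_solution_def \<psi>_def m_def g_def by simp
  qed
  have m_le_w: "m y \<le> w y" for y using OS_B[of y] w_off[of y] by (cases "y \<in> B") auto
  have \<psi>_le: "\<psi> y \<le> exp (w y)" if "y \<in> B" for y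
    using OS_B[OF that] \<psi>_pos[of y] by (metis exp_le_cancel_iff exp_ln max.cobounded1)
  \<comment> \<open>Where the obstacle is not attained, the point lies in \<open>B\<close> and the
    maximum is its first argument: the one-step drift vanishes.\<close>
  have \<psi>_eq: "\<psi> y = exp (w y)" if "w y \<noteq> m y" for y
  proof -
    have "y \<in> B" using w_off that by blast
    then have "w y = ln (\<psi> y)" using OS_B[of y] that by (auto simp: max_def split: if_splits)
    then show ?thesis using \<psi>_pos[of y] by simp
  qed
  note Z_facts = g_cont K delta w_meas w_bnd
  note H_facts = g_cont K delta m_meas m_bnd
  let ?Z = "discounted_value g \<delta> w" and ?H = "discounted_value g \<delta> m"
  have H_le_Z: "?H k v \<le> ?Z k v" for k v
    by (simp add: discounted_value_def m_le_w)
  define J where "J = (\<lambda>\<rho> N. \<integral>v. ?H (the_enat (min (\<rho> v) (enat N))) v \<partial>P x)"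
  have J_pos: "0 < J \<rho> N" if "grid_stopping \<delta> \<rho>" for \<rho> N
  proof -
    interpret prob_space "P x" by (rule prob_space_law)
    have "(\<integral>v. exp (- (K * (real N * \<delta>) + W)) \<partial>P x) \<le> J \<rho> N"
      unfolding J_def
    proof (rule integral_mono[OF _ discounted_value_stopped_integrable[OF H_facts that]])
      fix v assume "v \<in> space (P x)"
      moreover have "the_enat (min (\<rho> v) (enat N)) \<le> N" by (cases "\<rho> v") auto
      ultimately show "exp (- (K * (real N * \<delta>) + W)) \<le> ?H (the_enat (min (\<rho> v) (enat N))) v"
        using discounted_value_bound(2)[OF H_facts] by simp
    qed simp
    then have "exp (- (K * (real N * \<delta>) + W)) \<le> J \<rho> N" using prob_space by simp
    then show ?thesis by (rule less_le_trans[OF exp_gt_zero])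
  qed
  \<comment> \<open>Truncation at an almost sure bound \<open>N\<close> of \<open>\<sigma>\<close>
    changes the integrand only on a null set, which reduces stopped values to the truncated
    expectations \<open>J\<close>.\<close>
  have stopped: "stopped_value Omega P X f c U B \<delta> w lam \<sigma> x = ln (J \<rho> N)"
    if \<rho>: "\<And>v. \<rho> v = min (\<sigma> v) (exit_index \<delta> X B v)" and gs: "grid_stopping \<delta> \<rho>"
      and N: "AE v in P x. \<sigma> v \<le> enat N" for \<sigma> \<rho> N
  proof -
    have "(\<integral>v. ?H (the_enat (\<rho> v)) v \<partial>P x) = J \<rho> N"
      unfolding J_def
    proof (rule integral_cong_AE)
      show "(\<lambda>v. ?H (the_enat (\<rho> v)) v) \<in> borel_measurable (P x)"
        using stopped_measurable[OF \<delta>0 gs discounted_value_measurable[OF H_facts]]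
        by (simp add: measurable_cong_sets[OF sets_law refl])
      show "(\<lambda>v. ?H (the_enat (min (\<rho> v) (enat N))) v) \<in> borel_measurable (P x)"
        using discounted_value_stopped_integrable[OF H_facts gs] by (rule borel_measurable_integrable)
      show "AE v in P x. ?H (the_enat (\<rho> v)) v = ?H (the_enat (min (\<rho> v) (enat N))) v"
        using N by eventually_elim (auto simp: \<rho> min_def intro: order_trans)
    qed
    then show ?thesis
      unfolding stopped_value_def
      by (simp add: Let_def discounted_value_def \<rho> g_def m_def)
  qed
  have gs_B: "grid_stopping \<delta> (exit_index \<delta> X B)"
    by (rule grid_stopping_exit_index[OF \<delta>0 B_borel])
  show ?thesis
  proof (rule antisym)
    show "(SUP \<sigma>\<in>grid_stopping_times_bdd Omega P F \<delta> x. ereal (stopped_value Omega P X f c U B \<delta> w lam \<sigma> x))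
      \<le> ereal (w x)"
    proof (rule SUP_least)
      fix \<sigma> assume "\<sigma> \<in> grid_stopping_times_bdd Omega P F \<delta> x"
      then obtain N where \<sigma>: "grid_stopping \<delta> \<sigma>" and N: "AE v in P x. \<sigma> v \<le> enat N"
        unfolding grid_stopping_times_bdd_def grid_stopping_iff_eq[OF \<delta>0] by blast
      define \<rho> where "\<rho> = (\<lambda>v. min (\<sigma> v) (exit_index \<delta> X B v))"
      have gs: "grid_stopping \<delta> \<rho>"
        unfolding \<rho>_def by (rule grid_stopping_min[OF \<delta>0 \<sigma> gs_B])
      have "J \<rho> N \<le> (\<integral>v. ?Z (the_enat (min (\<rho> v) (enat N))) v \<partial>P x)"
        unfolding J_def
        by (rule integral_mono[OF discounted_value_stopped_integrable[OF H_facts gs] discounted_value_stopped_integrable[OF Z_facts gs] H_le_Z])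
      also have "\<dots> \<le> exp (w x)"
      proof (rule discounted_value_supermartingale[OF Z_facts gs])
        fix k v assume "enat k < \<rho> v"
        then have "X (real k * \<delta>) v \<in> B" by (simp add: \<rho>_def less_exit_index_iff)
        from \<psi>_le[OF this]
        show "(\<integral>u. exp (path_int X g \<delta> u + w (X \<delta> u)) \<partial>P (X (real k * \<delta>) v)) \<le> exp (w (X (real k * \<delta>) v))"
          by (simp add: \<psi>_def)
      qed
      finally have "ln (J \<rho> N) \<le> w x"
        using J_pos[OF gs, of N] by (metis exp_le_cancel_iff exp_ln)
      then show "ereal (stopped_value Omega P X f c U B \<delta> w lam \<sigma> x) \<le> ereal (w x)"
        using stopped[OF _ gs N] by (simp add: \<rho>_def)
    qed
  next
    \<comment> \<open>The candidate optimal time is the first grid time with \<open>w = Mw\<close>,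
      written as an exit from the continuation set so that the exit-index lemmas apply.\<close>
    define \<tau> where "\<tau> = exit_index \<delta> X {y. w y \<noteq> m y}"
    have "{y. w y \<noteq> m y} \<in> sets borel" using w_meas m_meas by measurable
    then have gs\<tau>: "grid_stopping \<delta> \<tau>" unfolding \<tau>_def by (rule grid_stopping_exit_index[OF \<delta>0])
    have \<tau>_le: "\<tau> v \<le> exit_index \<delta> X B v" for v
      unfolding \<tau>_def by (rule exit_index_mono) (use w_off in blast)
    \<comment> \<open>Bounds the contribution of paths that have not stopped by step
      \<open>N\<close>; \<open>exp W\<close> dominates the terminal factor
      \<open>exp (w (X T v))\<close>.\<close>
    define r where "r = (\<lambda>N::nat. exp W * (exp (- lam * (real N * \<delta>)) * (\<integral>v. exp (path_int X f (real N * \<delta>) v) \<partial>P x)))"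
    have J_ge: "exp (w x) \<le> J \<tau> N + r N" for N
    proof -
      define T where "T = real N * \<delta>"
      have T: "0 \<le> T" unfolding T_def using \<delta>0 by simp
      have pg: "path_int X g T v = path_int X f T v - lam * T" if "v \<in> space Omega" for v
        using integral_diff[OF along_path_integral(1)[OF f(1) Kf that order_refl T] integrable_const_ivl, of lam] T
        by (simp add: path_int_def g_def mult.commute)
      have int_r: "integrable (P x) (\<lambda>v. exp W * (exp (- lam * T) * exp (path_int X f T v)))"
      proof (intro integrable_mult_right integrable_law_bounded)
        show "(\<lambda>v. exp (path_int X f T v)) \<in> borel_measurable Omega"
          using path_int_measurable[OF f(1) Kf T] by measurable
        show "\<bar>exp (path_int X f T v)\<bar> \<le> exp (Kf * T)" if "v \<in> space Omega" for v
          using path_int_bound[OF f(1) Kf that T] by simp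
      qed
      have "exp (w x) = (\<integral>v. ?Z (the_enat (min (\<tau> v) (enat N))) v \<partial>P x)"
      proof (rule discounted_value_martingale[OF Z_facts gs\<tau>, symmetric])
        fix k v assume "enat k < \<tau> v"
        then have "w (X (real k * \<delta>) v) \<noteq> m (X (real k * \<delta>) v)" by (auto simp: \<tau>_def less_exit_index_iff)
        from \<psi>_eq[OF this]
        show "(\<integral>u. exp (path_int X g \<delta> u + w (X \<delta> u)) \<partial>P (X (real k * \<delta>) v)) = exp (w (X (real k * \<delta>) v))"
          by (simp add: \<psi>_def)
      qed
      also have "\<dots> \<le> (\<integral>v. ?H (the_enat (min (\<tau> v) (enat N))) v + exp W * (exp (- lam * T) * exp (path_int X f T v)) \<partial>P x)"
      proof (rule integral_mono[OF discounted_value_stopped_integrable[OF Z_facts gs\<tau>]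
            Bochner_Integration.integrable_add[OF discounted_value_stopped_integrable[OF H_facts gs\<tau>] int_r]])
        fix v assume "v \<in> space (P x)"
        then have v: "v \<in> space Omega" by simp
        show "?Z (the_enat (min (\<tau> v) (enat N))) v \<le>
          ?H (the_enat (min (\<tau> v) (enat N))) v + exp W * (exp (- lam * T) * exp (path_int X f T v))"
        \<comment> \<open>Before \<open>\<tau>\<close> the whole value is charged to the error term;
          once \<open>\<tau>\<close> has occurred, \<open>w = Mw\<close> at the stopped position and
          the two processes agree.\<close>
        proof (cases "enat N < \<tau> v")
          case True
          then have "min (\<tau> v) (enat N) = enat N" by (simp add: min.absorb2)
          moreover have "?Z N v \<le> exp W * (exp (- lam * T) * exp (path_int X f T v))"
            using w_bnd[of "X T v"] pg[OF v]
            by (simp add: discounted_value_def T_def[symmetric] exp_add[symmetric] abs_le_iff)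
          moreover have "0 \<le> ?H N v" by (simp add: discounted_value_def)
          ultimately show ?thesis by simp
        next
          case False
          then obtain k where k: "\<tau> v = enat k" "k \<le> N" by (cases "\<tau> v") auto
          from exit_index_eqD[OF k(1)[unfolded \<tau>_def]]
          have "w (X (real k * \<delta>) v) = m (X (real k * \<delta>) v)" by simp
          then have "?Z k v = ?H k v" by (simp add: discounted_value_def)
          then show ?thesis using k by simp
        qed
      qed
      also have "\<dots> = J \<tau> N + r N"
        using Bochner_Integration.integral_add[OF discounted_value_stopped_integrable[OF H_facts gs\<tau>, of x N] int_r]
        by (simp add: J_def r_def T_def)
      finally show ?thesis .
    qed
    have r_lim: "r \<longlonglongrightarrow> 0"
    proof -
      have "filterlim (\<lambda>N. real N * \<delta>) at_top sequentially"
        using delta by (intro filterlim_at_top_mult_tendsto_pos[OF tendsto_const] filterlim_real_sequentially)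
      from filterlim_compose[OF discounted_expectation_tendsto_0[OF f(1) Kf _ lam_gt, of x] this] f(3)
      have "(\<lambda>N. exp (- lam * (real N * \<delta>)) * (\<integral>v. exp (path_int X f (real N * \<delta>) v) \<partial>P x)) \<longlonglongrightarrow> 0"
        by simp
      from tendsto_mult_right_zero[OF this, of "exp W"] show ?thesis
        unfolding r_def .
    qed
    define S where "S = (SUP \<sigma>\<in>grid_stopping_times_bdd Omega P F \<delta> x. ereal (stopped_value Omega P X f c U B \<delta> w lam \<sigma> x))"
    have J_le: "ereal (ln (J \<tau> N)) \<le> S" for N
    proof -
      define \<sigma> where "\<sigma> = (\<lambda>v. min (\<tau> v) (enat N))"
      have gs: "grid_stopping \<delta> \<sigma>"
        unfolding \<sigma>_def by (rule grid_stopping_min[OF \<delta>0 gs\<tau> grid_stopping_const[OF \<delta>0]])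
      \<comment> \<open>Since \<open>\<tau>\<close> never exceeds the exit time, the additional
        minimum in \<open>stopped_value\<close> leaves this truncated time unchanged.\<close>
      have \<sigma>_eq: "\<sigma> v = min (\<sigma> v) (exit_index \<delta> X B v)" for v
        using \<tau>_le[of v] unfolding \<sigma>_def by (auto simp: min_def)
      have le: "AE v in P x. \<sigma> v \<le> enat N" by (simp add: \<sigma>_def)
      have "\<sigma> \<in> grid_stopping_times_bdd Omega P F \<delta> x"
        using gs le unfolding grid_stopping_times_bdd_def grid_stopping_iff_eq[OF \<delta>0] by blast
      then have "ereal (stopped_value Omega P X f c U B \<delta> w lam \<sigma> x) \<le> S"
        unfolding S_def by (rule SUP_upper)
      moreover have "J \<sigma> N = J \<tau> N" by (simp add: J_def \<sigma>_def)
      ultimately show ?thesis using stopped[OF \<sigma>_eq gs le] by simp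
    qed
    have "(\<lambda>N. exp (w x) - r N) \<longlonglongrightarrow> exp (w x) - 0" by (intro tendsto_intros r_lim)
    then have lim: "(\<lambda>N. exp (w x) - r N) \<longlonglongrightarrow> exp (w x)" by simp
    then have "(\<lambda>N. ln (exp (w x) - r N)) \<longlonglongrightarrow> ln (exp (w x))" by (rule tendsto_ln) simp
    then have "(\<lambda>N. ereal (ln (exp (w x) - r N))) \<longlonglongrightarrow> ereal (w x)" by simp
    \<comment> \<open>The inequality holds only eventually: monotonicity of \<open>ln\<close> is
      applied once \<open>exp (w x) - r N\<close> is positive.\<close>
    moreover have "\<forall>\<^sub>F N in sequentially. ereal (ln (exp (w x) - r N)) \<le> S"
      using order_tendstoD(1)[OF lim exp_gt_zero]
    proof eventually_elim
      case (elim N)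
      then have "ln (exp (w x) - r N) \<le> ln (J \<tau> N)"
        using J_ge[of N] by (intro ln_mono) auto
      then show ?case using J_le[of N] by (meson ereal_less_eq(3) order_trans)
    qed
    ultimately have "ereal (w x) \<le> S"
      by (rule tendsto_upperbound) simp
    then show "ereal (w x) \<le> (SUP \<sigma>\<in>grid_stopping_times_bdd Omega P F \<delta> x. ereal (stopped_value Omega P X f c U B \<delta> w lam \<sigma> x))"
      by (simp add: S_def)
  qed
qed

end
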